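(* Let $(G,H,\mathcal L)$ be a cut-and-project scheme with $G,H$ locally compact second countable abelian groups, and suppose that $W\subseteq H$ is measurable, relatively compact and Haar aperiodic. Then the measure-preserving $G$-system $(\mathcal M_W^G,Q_W^G,S)$ (the extended hull with its Mirsky measure) is measure-theoretically isomorphic to $(\widetilde X,m_{\widetilde X},\widetilde T)$.
   Context: Setting. $G,H$ are locally compact second countable abelian groups with Haar measures $m_G,m_H$. $\mathcal L\subseteq G\times H$ is a co-compact lattice (discrete co-compact subgroup) such that the canonical projection $\pi^G:G\times H\to G$ is injective on $\mathcal L$ and the image of $\mathcal L$ under the canonical projection $\pi^H:G\times H\to H$ is dense in $H$; $(G,H,\mathcal L)$ is called a cut-and-project scheme. Measurable means Borel measurable. Torus. $\widetilde X=(G\times H)/\mathcal L$ is a compact abelian group with normalised Haar measure $m_{\widetilde X}$, and $\widetilde T$ is the $G$-action $\widetilde T_g\tilde x=(g,0)+\tilde x$. Extended hull. For $\tilde x=x+\mathcal L\in\widetilde X$ put $\nu_W(\tilde x)=\sum_{y\in(x+\mathcal L)\cap(G\times W)}\delta_y$ (a measure on $G\times H$, where $\delta_y$ is the unit point mass at $y$) and $\nu_W^G(\tilde x)=\pi^G_*(\nu_W(\tilde x))$ (its push-forward to $G$). $\mathcal M_W^G$ is the closure of $\nu_W^G(\widetilde X)$ in the vague topology on the space of regular Borel measures on $G$; it carries the $G$-action $(S_g\nu)(A)=\nu(A-g)$. The Mirsky measure on $\mathcal M_W^G$ is $Q_W^G=m_{\widetilde X}\circ(\nu_W^G)^{-1}$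 (the map $\nu_W^G$ is measurable). Haar aperiodicity. $W$ is Haar aperiodic if $m_H((h+W)\triangle W)=0$ implies $h=0$, for $h\in H$. Measure-theoretic isomorphism of two probability-preserving $G$-systems means a bimeasurable, measure-preserving, $G$-equivariant bijection between invariant measurable subsets of full measure.
   Formalization: The window W is additionally assumed nonempty; this follows from Haar aperiodicity unless H is trivial, and for H={0}, W=∅ (e.g. G=ℝ, L=ℤ×{0}) the claim as stated fails because the hull is a single point while the torus is a circle. *)

theory Defs
  imports "HOL-Probability.Probability"
begin

section \<open>Borel, regular and Haar measures on abstract topologies\<close>

definition borel_of :: "'a topology \<Rightarrow> 'a measure" where
  "borel_of T = sigma (topspace T) {U. openin T U}"

definition regular_borel_measure :: "'a topology \<Rightarrow> 'a measure \<Rightarrow> bool" where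
  "regular_borel_measure T m \<longleftrightarrow>
     sets m = sets (borel_of T) \<and>
     (\<forall>K. compactin T K \<longrightarrow> emeasure m K < \<infinity>) \<and>
     (\<forall>A\<in>sets m. emeasure m A = (INF U\<in>{U. openin T U \<and> A \<subseteq> U}. emeasure m U)) \<and>
     (\<forall>U. openin T U \<longrightarrow> emeasure m U = (SUP K\<in>{K. compactin T K \<and> K \<subseteq> U}. emeasure m K))"

text \<open>Only the addition on \<^term>\<open>topspace T\<close> matters. The class \<^class>\<open>plus\<close> covers both
  topological groups that are types and quotient groups, whose elements are cosets added by
  the Minkowski sum of \<^theory>\<open>HOL-Library.Set_Algebras\<close>.\<close>

definition haar_measure :: "('a::plus) topology \<Rightarrow> 'a measure \<Rightarrow> bool" where
  "haar_measure T m \<longleftrightarrow>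
     regular_borel_measure T m \<and>
     emeasure m (topspace T) \<noteq> 0 \<and>
     (\<forall>x\<in>topspace T. \<forall>A\<in>sets m. emeasure m ((\<lambda>y. x + y) ` A) = emeasure m A)"

lemma sets_borel_of_euclidean: "sets (borel_of euclidean) = sets borel"
  by (simp add: borel_of_def borel_def)


section \<open>Quotient topologies\<close>

definition quotient_topology :: "'a topology \<Rightarrow> ('a \<Rightarrow> 'b) \<Rightarrow> 'b topology" where
  "quotient_topology X q =
     topology (\<lambda>U. U \<subseteq> q ` topspace X \<and> openin X {x \<in> topspace X. q x \<in> U})"

lemma openin_quotient_topology:
  "openin (quotient_topology X q) U \<longleftrightarrow>
     U \<subseteq> q ` topspace X \<and> openin X {x \<in> topspace X. q x \<in> U}"
proof -
  have "istopology (\<lambda>U. U \<subseteq> q ` topspace X \<and> openin X {x \<in> topspace X. q x \<in> U})"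
    unfolding istopology_def
  proof (intro conjI allI impI)
    fix S T
    assume S: "S \<subseteq> q ` topspace X \<and> openin X {x \<in> topspace X. q x \<in> S}"
      and T: "T \<subseteq> q ` topspace X \<and> openin X {x \<in> topspace X. q x \<in> T}"
    show "S \<inter> T \<subseteq> q ` topspace X" using S by blast
    have "{x \<in> topspace X. q x \<in> S \<inter> T} =
        {x \<in> topspace X. q x \<in> S} \<inter> {x \<in> topspace X. q x \<in> T}" by blast
    then show "openin X {x \<in> topspace X. q x \<in> S \<inter> T}" using S T by auto
  next
    fix \<K>
    assume K: "\<forall>K\<in>\<K>. K \<subseteq> q ` topspace X \<and> openin X {x \<in> topspace X. q x \<in> K}"
    show "\<Union>\<K> \<subseteq> q ` topspace X" using K by blast
    have "{x \<in> topspace X. q x \<in> \<Union>\<K>} = (\<Union>K\<in>\<K>. {x \<in> topspace X. q x \<in> K})" by blast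
    then show "openin X {x \<in> topspace X. q x \<in> \<Union>\<K>}" using K by auto
  qed
  then show ?thesis by (simp add: quotient_topology_def)
qed

lemma topspace_quotient_topology: "topspace (quotient_topology X q) = q ` topspace X"
proof -
  have "{x \<in> topspace X. q x \<in> q ` topspace X} = topspace X" by auto
  then have "openin (quotient_topology X q) (q ` topspace X)"
    by (simp add: openin_quotient_topology)
  then show ?thesis
    by (metis openin_quotient_topology openin_subset openin_topspace subset_antisym)
qed

lemma quotient_map_quotient_topology: "quotient_map X (quotient_topology X q) q"
  by (simp add: quotient_map_def topspace_quotient_topology openin_quotient_topology)


section \<open>Cut-and-project schemes and their torus\<close>

definition torus :: "('a::plus) set \<Rightarrow> 'a set set" where
  "torus L = range (\<lambda>x. x +o L)"

definition torus_topology :: "('a::{topological_space,plus}) set \<Rightarrow> 'a set topology" where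
  "torus_topology L = quotient_topology euclidean (\<lambda>x. x +o L)"

lemma topspace_torus_topology: "topspace (torus_topology L) = torus L"
  by (simp add: torus_topology_def torus_def topspace_quotient_topology)

definition cut_and_project_scheme ::
    "('g::topological_ab_group_add \<times> 'h::topological_ab_group_add) set \<Rightarrow> bool" where
  "cut_and_project_scheme L \<longleftrightarrow>
     locally_compact_space (euclidean :: 'g topology) \<and>
     locally_compact_space (euclidean :: 'h topology) \<and>
     0 \<in> L \<and> (\<forall>x\<in>L. \<forall>y\<in>L. x + y \<in> L) \<and> (\<forall>x\<in>L. - x \<in> L) \<and>
     (\<forall>x\<in>L. x isolated_in L) \<and>
     compact_space (torus_topology L) \<and>
     inj_on fst L \<and>
     closure (snd ` L) = UNIV"

definition torus_shift :: "'g \<Rightarrow> ('g::plus \<times> 'h::{plus,zero}) set \<Rightarrow> ('g \<times> 'h) set" where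
  "torus_shift g c = (g, 0) +o c"

definition haar_aperiodic :: "('h::{topological_space,plus,zero}) measure \<Rightarrow> 'h set \<Rightarrow> bool" where
  "haar_aperiodic mH W \<longleftrightarrow>
     (\<forall>h. emeasure mH (sym_diff ((\<lambda>w. h + w) ` W) W) = 0 \<longrightarrow> h = 0)"

text \<open>Only over a trivial group can the empty set be Haar aperiodic.\<close>

lemma haar_aperiodic_nonempty:
  fixes W :: "'h::{topological_space,plus,zero} set" and h :: 'h
  assumes "haar_aperiodic mH W" and "h \<noteq> 0"
  shows "W \<noteq> {}"
proof
  assume "W = {}"
  then have "emeasure mH (sym_diff ((\<lambda>w. h + w) ` W) W) = 0" by simp
  with assms(1) have "h = 0" unfolding haar_aperiodic_def by blast
  with assms(2) show False ..
qed


section \<open>The extended hull and its Mirsky measure\<close>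

definition point_masses :: "('a::topological_space) set \<Rightarrow> 'a measure" where
  "point_masses S =
     measure_of UNIV (sets borel) (\<lambda>A. \<Sum>\<^sub>\<infinity>y\<in>S. emeasure (return borel y) A)"

text \<open>The set function in this definition is a measure, so \<^const>\<open>measure_of\<close> does not
  default to the null measure.\<close>

lemma infsum_return:
  fixes A S :: "('a::topological_space) set"
  assumes "A \<in> sets borel"
  shows "(\<Sum>\<^sub>\<infinity>y\<in>S. emeasure (return borel y) A) = emeasure (count_space S) (S \<inter> A)"
proof -
  have "(\<Sum>\<^sub>\<infinity>y\<in>S. emeasure (return borel y) A) = (\<Sum>\<^sub>\<infinity>y\<in>S \<inter> A. (1::ennreal))"
    using assms by (intro infsum_cong_neutral) auto
  also have "\<dots> = emeasure (count_space S) (S \<inter> A)"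
  proof (cases "finite (S \<inter> A)")
    case True
    then show ?thesis by (simp add: emeasure_count_space)
  next
    case False
    then show ?thesis
      by (subst infsum_superconst_infinite_ennreal[where b = 1])
        (auto simp: emeasure_count_space)
  qed
  finally show ?thesis .
qed

lemma emeasure_point_masses:
  fixes A S :: "('a::topological_space) set"
  assumes "A \<in> sets borel"
  shows "emeasure (point_masses S) A = (\<Sum>\<^sub>\<infinity>y\<in>S. emeasure (return borel y) A)"
proof (rule emeasure_measure_of[OF point_masses_def])
  let ?\<mu> = "\<lambda>A. \<Sum>\<^sub>\<infinity>y\<in>S. emeasure (return borel y) A"
  have sets: "sets (point_masses S) = sets borel"
    unfolding point_masses_def
    by (metis sets.sigma_sets_eq sets.space_closed sets_measure_of space_borel)
  show "sets borel \<subseteq> Pow (UNIV :: 'a set)" by simp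
  show "A \<in> sets (point_masses S)" using assms sets by simp
  show "positive (sets (point_masses S)) ?\<mu>"
    by (simp add: positive_def)
  show "countably_additive (sets (point_masses S)) ?\<mu>"
    unfolding countably_additive_def
  proof (intro allI impI)
    fix B :: "nat \<Rightarrow> 'a set"
    assume B: "range B \<subseteq> sets (point_masses S)" and disj: "disjoint_family B"
      and "(\<Union>i. B i) \<in> sets (point_masses S)"
    have *: "B i \<in> sets borel" for i using B sets by auto
    have "(\<Sum>i. ?\<mu> (B i)) = (\<Sum>i. emeasure (count_space S) (S \<inter> B i))"
      by (simp only: infsum_return[OF *])
    also have "\<dots> = emeasure (count_space S) (\<Union>i. S \<inter> B i)"
      using disj by (intro suminf_emeasure) (auto simp: disjoint_family_on_def)
    also have "(\<Union>i. S \<inter> B i) = S \<inter> (\<Union>i. B i)" by blast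
    also have "emeasure (count_space S) (S \<inter> (\<Union>i. B i)) = ?\<mu> (\<Union>i. B i)"
      by (subst infsum_return) (auto simp: *)
    finally show "(\<Sum>i. ?\<mu> (B i)) = ?\<mu> (\<Union>i. B i)" .
  qed
qed

definition nu :: "'h set \<Rightarrow> ('g::topological_space \<times> 'h::topological_space) set \<Rightarrow>
    ('g \<times> 'h) measure" where
  "nu W c = point_masses (c \<inter> (UNIV \<times> W))"

definition nu_G :: "'h set \<Rightarrow> ('g::topological_space \<times> 'h::topological_space) set \<Rightarrow>
    'g measure" where
  "nu_G W c = distr (nu W c) borel fst"

definition vague_topology :: "('g::topological_space) measure topology" where
  "vague_topology = topology_generated_by
     {{m. regular_borel_measure euclidean m \<and> (\<integral>x. f x \<partial>m) \<in> U} | (f :: 'g \<Rightarrow> real) U.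
        continuous_on UNIV f \<and> compact (closure {x. f x \<noteq> 0}) \<and> open U}"

lemma topspace_vague_topology:
  "topspace (vague_topology :: 'g::topological_space measure topology) =
     {m. regular_borel_measure euclidean m}"
proof -
  have "{m :: 'g measure. regular_borel_measure euclidean m} \<in>
      {{m. regular_borel_measure euclidean m \<and> (\<integral>x. f x \<partial>m) \<in> U} | (f :: 'g \<Rightarrow> real) U.
        continuous_on UNIV f \<and> compact (closure {x. f x \<noteq> 0}) \<and> open U}"
    by (rule CollectI, rule exI[of _ "\<lambda>_. 0"], rule exI[of _ UNIV]) auto
  then show ?thesis
    unfolding vague_topology_def topology_generated_by_topspace by blast
qed

definition extended_hull ::
    "('g::{topological_space,plus} \<times> 'h::{topological_space,plus}) set \<Rightarrow> 'h set \<Rightarrow> 'g measure set"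
  where "extended_hull L W = vague_topology closure_of (nu_G W ` torus L)"

definition measure_shift :: "'g \<Rightarrow> ('g::{topological_space,plus}) measure \<Rightarrow> 'g measure" where
  "measure_shift g m = distr m borel (\<lambda>x. g + x)"

definition mirsky_measure ::
    "('g \<times> 'h) set measure \<Rightarrow>
     ('g::{topological_space,plus} \<times> 'h::{topological_space,plus}) set \<Rightarrow>
     'h set \<Rightarrow> 'g measure measure" where
  "mirsky_measure mX L W =
     distr mX (borel_of (subtopology vague_topology (extended_hull L W))) (nu_G W)"

lemma space_mirsky_measure: "space (mirsky_measure mX L W) = extended_hull L W"
  by (simp add: mirsky_measure_def borel_of_def extended_hull_def space_measure_of_conv
      closure_of_subset_topspace inf.absorb2)


section \<open>Measure-theoretic isomorphism\<close>

definition prob_preserving_system :: "'x measure \<Rightarrow> ('g::group_add \<Rightarrow> 'x \<Rightarrow> 'x) \<Rightarrow> bool" where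
  "prob_preserving_system M T \<longleftrightarrow>
     prob_space M \<and>
     (\<forall>g. T g \<in> M \<rightarrow>\<^sub>M M \<and> distr M M (T g) = M) \<and>
     (\<forall>x\<in>space M. T 0 x = x) \<and>
     (\<forall>g h. \<forall>x\<in>space M. T (g + h) x = T g (T h x))"

definition isomorphic_systems ::
    "'x measure \<Rightarrow> ('g::group_add \<Rightarrow> 'x \<Rightarrow> 'x) \<Rightarrow> 'y measure \<Rightarrow> ('g \<Rightarrow> 'y \<Rightarrow> 'y) \<Rightarrow> bool" where
  "isomorphic_systems M S N T \<longleftrightarrow>
     prob_preserving_system M S \<and> prob_preserving_system N T \<and>
     (\<exists>A\<in>sets M. \<exists>B\<in>sets N. \<exists>\<phi>.
        emeasure M A = 1 \<and> emeasure N B = 1 \<and>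
        (\<forall>g. S g ` A = A) \<and> (\<forall>g. T g ` B = B) \<and>
        bij_betw \<phi> A B \<and>
        \<phi> \<in> restrict_space M A \<rightarrow>\<^sub>M restrict_space N B \<and>
        the_inv_into A \<phi> \<in> restrict_space N B \<rightarrow>\<^sub>M restrict_space M A \<and>
        distr (restrict_space M A) (restrict_space N B) \<phi> = restrict_space N B \<and>
        (\<forall>g. \<forall>x\<in>A. \<phi> (S g x) = T g (\<phi> x)))"

end

theory Submission
  imports Defs
begin

text \<open>
  The map \<open>nu_G W\<close> from the torus to the extended hull is equivariant and takes the Haar measure to the
  Mirsky measure, so the hull is a factor of the torus. A factor map is an isomorphism as soon as it is
  injective on an invariant conull Borel set and takes Borel subsets of this set to Borel sets
  (\<open>isomorphic_systems_of_injective_factor\<close>). The proof finds such a set of cosets.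

  Injectivity. Let two cosets have a common nonempty pattern. The projection to \<open>'g\<close> is injective on the
  lattice, so the cosets have representatives with equal first coordinates whose second coordinates
  \<open>h\<close> and \<open>h'\<close> satisfy \<open>h + d \<in> W \<longleftrightarrow> h' + d \<in> W\<close> for all \<open>d\<close> in the countable dense subgroup
  \<open>D = snd ` L\<close> (\<open>support_shift\<close>, \<open>pattern_injective\<close>). For almost every \<open>h\<close>, the trace of \<open>W - h\<close> on \<open>D\<close>
  determines \<open>W - h\<close> up to a null set (\<open>dense_translates_approximate\<close>): translation of \<open>W\<close> is continuous in
  measure, so each \<open>x\<close> can be approximated by elements \<open>d n x\<close> of \<open>D\<close> so fast that, by Borel and Cantelli and
  Fubini, for almost all \<open>h\<close> and almost all \<open>x\<close> the truth value of \<open>h + x \<in> W\<close> is the eventual truth value of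
  \<open>h + d n x \<in> W\<close>. For two such points \<open>h\<close> and \<open>h'\<close> the sets \<open>W - h\<close> and \<open>W - h'\<close> agree up to a null set, and
  Haar aperiodicity gives \<open>h = h'\<close> (\<open>generic_points\<close>).

  Measurability. A pattern changes discontinuously only when a point of the coset enters or leaves the
  strip over \<open>W\<close>, and finitely many window conditions \<open>h + snd l \<in> W\<close> control this near a given base point
  (\<open>pattern_locally_continuous\<close>). Hence \<open>nu_G W\<close> is Borel. By Lusin's argument almost all of \<open>'h\<close> is
  covered by countably many compact sets \<open>C n\<close> of generic points on which all window conditions are locally
  constant (\<open>conull_compact_clopen_pieces\<close>). On \<open>UNIV \<times> C n\<close> the pattern is continuous, so it maps compact
  sets to compact sets, which are closed because the vague topology is Hausdorff
  (\<open>image_generic_cosets\<close>).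

  Conullity. The cosets that meet \<open>UNIV \<times> (\<Union>n. C n)\<close> form a set that is invariant under the action of
  \<open>'g\<close>. It is conull by Fubini, applied to the Haar measures of the torus and of \<open>'h\<close>, and by translation
  invariance on the torus (\<open>conull_cosets\<close>).
\<close>

section \<open>Products of topological groups\<close>

instance prod :: (topological_monoid_add, topological_monoid_add) topological_monoid_add
proof
  fix a b :: "'a \<times> 'b"
  have "((\<lambda>x. (fst (fst x) + fst (snd x), snd (fst x) + snd (snd x))) \<longlongrightarrow>
      (fst a + fst b, snd a + snd b)) (nhds (a, b))"
    by (intro tendsto_intros)
      (auto simp: nhds_prod intro!: tendsto_fst tendsto_snd filterlim_fst filterlim_snd)
  then show "LIM x (nhds a \<times>\<^sub>F nhds b). fst x + snd x :> nhds (a + b)"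
    by (simp add: nhds_prod plus_prod_def)
qed

instance prod :: (topological_comm_monoid_add, topological_comm_monoid_add)
  topological_comm_monoid_add ..

instance prod :: (topological_group_add, topological_group_add) topological_group_add
proof
  fix a :: "'a \<times> 'b"
  have "((\<lambda>x. (- fst x, - snd x)) \<longlongrightarrow> (- fst a, - snd a)) (nhds a)"
    by (intro tendsto_intros) (auto intro!: tendsto_fst tendsto_snd filterlim_ident)
  moreover have "uminus = (\<lambda>x :: 'a \<times> 'b. (- fst x, - snd x))"
    by (simp add: fun_eq_iff uminus_prod_def)
  moreover have "- a = (- fst a, - snd a)" by (simp add: uminus_prod_def)
  ultimately show "(uminus \<longlongrightarrow> - a) (nhds a)" by simp
qed

instance prod :: (topological_ab_group_add, topological_ab_group_add) topological_ab_group_add ..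

section \<open>Borel sets of abstract topologies\<close>

lemma space_borel_of [simp]: "space (borel_of T) = topspace T"
  by (simp add: borel_of_def space_measure_of_conv)

lemma sets_borel_of: "sets (borel_of T) = sigma_sets (topspace T) {U. openin T U}"
  unfolding borel_of_def by (rule sets_measure_of) (auto dest: openin_subset)

lemma openin_in_borel_of: "openin T U \<Longrightarrow> U \<in> sets (borel_of T)"
  by (auto simp: sets_borel_of)

lemma closedin_in_borel_of:
  assumes "closedin T C"
  shows "C \<in> sets (borel_of T)"
proof -
  have "topspace T - (topspace T - C) \<in> sets (borel_of T)"
    using assms by (intro sets.Diff openin_in_borel_of) (auto simp: closedin_def)
  moreover have "topspace T - (topspace T - C) = C"
    using closedin_subset[OF assms] by blast
  ultimately show ?thesis by simp
qed

lemma measurable_into_borel_of: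
  assumes "f \<in> space M \<rightarrow> topspace T"
    and "\<And>U. openin T U \<Longrightarrow> f -` U \<inter> space M \<in> sets M"
  shows "f \<in> M \<rightarrow>\<^sub>M borel_of T"
  unfolding borel_of_def
  by (rule measurable_measure_of) (use assms in \<open>auto dest: openin_subset\<close>)

lemma continuous_map_measurable:
  assumes "continuous_map T T' f"
  shows "f \<in> borel_of T \<rightarrow>\<^sub>M borel_of T'"
proof (rule measurable_into_borel_of)
  show "f \<in> space (borel_of T) \<rightarrow> topspace T'"
    using assms by (auto simp: continuous_map_def)
  fix U assume "openin T' U"
  then have "openin T {x \<in> topspace T. f x \<in> U}"
    using assms by (simp add: continuous_map_def)
  moreover have "{x \<in> topspace T. f x \<in> U} = f -` U \<inter> space (borel_of T)" by auto
  ultimately show "f -` U \<inter> space (borel_of T) \<in> sets (borel_of T)"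
    using openin_in_borel_of by metis
qed

section \<open>Locally compact groups and their discrete subgroups\<close>

lemma locally_compact_nhd:
  assumes "locally_compact_space (euclidean :: 'a::topological_space topology)"
  obtains U K where "open U" "(x::'a) \<in> U" "U \<subseteq> K" "compact K"
  using assms unfolding locally_compact_space_def by (metis UNIV_I compactin_euclidean_iff open_openin topspace_euclidean)

lemma locally_compact_prod:
  assumes "locally_compact_space (euclidean :: 'a::topological_space topology)"
    and "locally_compact_space (euclidean :: 'b::topological_space topology)"
  shows "locally_compact_space (euclidean :: ('a \<times> 'b) topology)"
  unfolding locally_compact_space_def
proof (intro ballI)
  fix z :: "'a \<times> 'b"
  obtain U K where 1: "open U" "fst z \<in> U" "U \<subseteq> K" "compact K"
    using locally_compact_nhd[OF assms(1)] .
  obtain V J where 2: "open V" "snd z \<in> V" "V \<subseteq> J" "compact J"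
    using locally_compact_nhd[OF assms(2)] .
  have "open (U \<times> V)" "z \<in> U \<times> V" "U \<times> V \<subseteq> K \<times> J" "compact (K \<times> J)"
    using 1 2 by (auto simp: mem_Times_iff intro: open_Times compact_Times)
  then show "\<exists>U K. openin euclidean U \<and> compactin euclidean K \<and> z \<in> U \<and> U \<subseteq> K"
    by auto
qed

lemma countable_subfamily:
  fixes \<F> :: "'a::second_countable_topology set set"
  assumes "\<forall>S\<in>\<F>. open S"
  shows "\<exists>\<F>'. \<F>' \<subseteq> \<F> \<and> countable \<F>' \<and> \<Union>\<F>' = \<Union>\<F>"
proof (rule Lindelof[of \<F>])
  show "open S" if "S \<in> \<F>" for S using assms that by blast
next
  fix \<F>' assume "\<F>' \<subseteq> \<F>" "countable \<F>'" "\<Union>\<F>' = \<Union>\<F>"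
  then show ?thesis by blast
qed

lemma sigma_compact:
  assumes "locally_compact_space (euclidean :: 'a::second_countable_topology topology)"
  obtains R :: "nat \<Rightarrow> 'a::second_countable_topology set" where "\<forall>n. compact (R n)" "(\<Union>n. R n) = UNIV"
proof -
  let ?F = "{U::'a set. open U \<and> (\<exists>K. compact K \<and> U \<subseteq> K)}"
  have "\<exists>F\<subseteq>?F. countable F \<and> \<Union>F = \<Union>?F"
    by (rule countable_subfamily) simp
  then obtain F where F: "F \<subseteq> ?F" "countable F" "\<Union>F = \<Union>?F" by metis
  have "x \<in> \<Union>?F" for x
  proof -
    obtain U K where "open U" "x \<in> U" "U \<subseteq> K" "compact K"
      using locally_compact_nhd[OF assms] .
    then show ?thesis by blast
  qed
  then have U: "\<Union>F = UNIV" unfolding F(3) by blast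
  then have ne: "F \<noteq> {}" by auto
  have "\<forall>U\<in>F. \<exists>K. compact K \<and> U \<subseteq> K" using F(1) by auto
  then obtain k where k: "\<And>U. U \<in> F \<Longrightarrow> compact (k U) \<and> U \<subseteq> k U" by metis
  show ?thesis
  proof
    show "\<forall>n. compact (k (from_nat_into F n))"
      using k from_nat_into[OF ne] by blast
    show "(\<Union>n. k (from_nat_into F n)) = UNIV"
    proof (intro set_eqI iffI UNIV_I)
      fix x :: 'a
      obtain U where "U \<in> F" "x \<in> U" using U by blast
      then show "x \<in> (\<Union>n. k (from_nat_into F n))"
        using k from_nat_into_surj[OF F(2)] by blast
    qed
  qed
qed

lemma compact_minus:
  fixes A B :: "'a::topological_ab_group_add set"
  assumes "compact A" "compact B"
  shows "compact ((\<lambda>(a, b). a - b) ` (A \<times> B))"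
  by (intro compact_continuous_image compact_Times assms)
    (auto simp: case_prod_unfold diff_conv_add_uminus simp del: add_uminus_conv_diff intro!: continuous_intros)

lemma open_translation:
  fixes U :: "'a::topological_ab_group_add set"
  assumes "open U"
  shows "open ((+) x ` U)"
proof -
  have "(+) x ` U = (\<lambda>y. - x + y) -` U"
    by (force simp: image_iff)
  then show ?thesis
    using assms by (auto intro!: open_vimage continuous_intros)
qed

lemma difference_nhd:
  fixes V :: "'a::topological_ab_group_add set"
  assumes "open V" "0 \<in> V"
  obtains U where "open U" "0 \<in> U" "\<forall>a\<in>U. \<forall>b\<in>U. a - b \<in> V"
proof -
  have "open ((\<lambda>(a, b). a + - b) -` V)"
    by (intro open_vimage assms) (auto simp: case_prod_unfold simp del: add_uminus_conv_diff intro!: continuous_intros)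
  then obtain A B where "open A" "open B" "(0, 0) \<in> A \<times> B" "A \<times> B \<subseteq> (\<lambda>(a, b). a + - b) -` V"
    using open_prod_elim[of "(\<lambda>(a, b). a + - b) -` V" "(0::'a, 0::'a)"] assms(2) by auto
  then show ?thesis
    by (intro that[of "A \<inter> B"]) auto
qed

lemma closed_Union_locally_finite:
  fixes K :: "'i \<Rightarrow> 'a::t2_space set"
  assumes lc: "locally_compact_space (euclidean :: 'a topology)"
    and cl: "\<And>i. i \<in> I \<Longrightarrow> closed (K i)"
    and fin: "\<And>Q. compact Q \<Longrightarrow> finite {i \<in> I. K i \<inter> Q \<noteq> {}}"
  shows "closed (\<Union>i\<in>I. K i)"
  unfolding closed_def
proof (subst open_subopen, intro ballI)
  fix y assume y: "y \<in> - (\<Union>i\<in>I. K i)"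
  obtain U Q where U: "open U" "y \<in> U" "U \<subseteq> Q" "compact Q"
    using locally_compact_nhd[OF lc] .
  let ?J = "{i \<in> I. K i \<inter> Q \<noteq> {}}"
  have "open (U - (\<Union>i\<in>?J. K i))"
    by (intro open_Diff U closed_UN fin) (auto intro: cl)
  moreover have "y \<in> U - (\<Union>i\<in>?J. K i)" using y U by auto
  moreover have "U - (\<Union>i\<in>?J. K i) \<subseteq> - (\<Union>i\<in>I. K i)" using U by auto
  ultimately show "\<exists>T. open T \<and> y \<in> T \<and> T \<subseteq> - (\<Union>i\<in>I. K i)" by blast
qed

locale discrete_subgroup =
  fixes L :: "'a::{topological_ab_group_add,t2_space,second_countable_topology} set"
  assumes lc: "locally_compact_space (euclidean :: 'a topology)"
    and zero_in: "0 \<in> L"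
    and add_in: "x \<in> L \<Longrightarrow> y \<in> L \<Longrightarrow> x + y \<in> L"
    and minus_in: "x \<in> L \<Longrightarrow> - x \<in> L"
    and isolated_zero: "0 isolated_in L"
begin

lemma diff_in: "x \<in> L \<Longrightarrow> y \<in> L \<Longrightarrow> x - y \<in> L"
  using add_in[of x "- y"] minus_in[of y] by simp

lemma mem_coset: "y \<in> x +o L \<longleftrightarrow> y - x \<in> L"
  by (auto simp: elt_set_plus_def intro!: bexI[of _ "y - x"])

lemma self_mem_coset: "x \<in> x +o L"
  by (simp add: mem_coset zero_in)

lemma coset_eq_iff: "x +o L = y +o L \<longleftrightarrow> y - x \<in> L"
proof
  assume "x +o L = y +o L"
  then show "y - x \<in> L" using self_mem_coset[of y] mem_coset by auto
next
  assume *: "y - x \<in> L"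
  show "x +o L = y +o L"
  proof (intro set_eqI)
    fix z
    show "z \<in> x +o L \<longleftrightarrow> z \<in> y +o L"
      using diff_in[of "z - x" "y - x"] add_in[of "z - y" "y - x"] *
      by (auto simp: mem_coset)
  qed
qed

lemma coset_in_torus [simp]: "x +o L \<in> torus L"
  by (simp add: torus_def)

lemma elt_plus_coset: "z +o (x +o L) = (z + x) +o L"
  by (rule set_plus_rearrange2)

text \<open>A neighbourhood that meets every coset in at most one point: the projection to the torus is
  injective on it and on each of its translates.\<close>

lemma separating_nhd:
  obtains U where "open U" "0 \<in> U" "\<forall>a\<in>U. \<forall>b\<in>U. a - b \<in> L \<longrightarrow> a = b"
proof -
  obtain V where V: "open V" "V \<inter> L = {0}"
    using isolated_inE[OF isolated_zero] by metis
  then have "0 \<in> V" by auto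
  with V(1) obtain U where U: "open U" "0 \<in> U" "\<forall>a\<in>U. \<forall>b\<in>U. a - b \<in> V"
    by (rule difference_nhd)
  show ?thesis
    using U V(2) by (intro that[of U]) (metis IntI eq_iff_diff_eq_0 singletonD)+
qed

lemma locally_finite:
  assumes "compact Q"
  shows "finite (L \<inter> Q)"
proof -
  obtain U where U: "open U" "0 \<in> U" "\<forall>a\<in>U. \<forall>b\<in>U. a - b \<in> L \<longrightarrow> a = b"
    by (rule separating_nhd)
  have "Q \<subseteq> (\<Union>y\<in>Q. (+) y ` U)" using U(2) by force
  then obtain F where F: "F \<subseteq> Q" "finite F" "Q \<subseteq> (\<Union>y\<in>F. (+) y ` U)"
    using compactE_image[OF assms, of Q "\<lambda>y. (+) y ` U"] open_translation[OF U(1)] by metis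
  have "finite (L \<inter> (+) y ` U)" for y
  proof -
    have "a = b" if "a \<in> L \<inter> (+) y ` U" "b \<in> L \<inter> (+) y ` U" for a b
      using that U(3) diff_in by force
    then have "L \<inter> (+) y ` U \<subseteq> {SOME a. a \<in> L \<inter> (+) y ` U}"
      by (metis (no_types, lifting) singletonI someI subsetI)
    then show ?thesis by (rule finite_subset) simp
  qed
  then have "finite (\<Union>y\<in>F. L \<inter> (+) y ` U)" using F(2) by blast
  then show ?thesis by (rule rev_finite_subset) (use F(3) in blast)
qed

lemma countable: "countable L"
proof -
  obtain R :: "nat \<Rightarrow> 'a set" where R: "\<forall>n. compact (R n)" "(\<Union>n. R n) = UNIV"
    using sigma_compact[OF lc] .
  have "countable (\<Union>n. L \<inter> R n)"
    using locally_finite R(1) by (intro countable_UN countableI_type countable_finite) auto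
  moreover have "(\<Union>n. L \<inter> R n) = L" using R(2) by blast
  ultimately show ?thesis by simp
qed

text \<open>The translates of \<open>K\<close> by the subgroup form a locally finite family. This is what makes images of
  compact sets closed in the torus.\<close>

lemma closed_compact_plus:
  assumes "compact K"
  shows "closed {x. \<exists>l\<in>L. x + l \<in> K}"
proof -
  have "{x. \<exists>l\<in>L. x + l \<in> K} = (\<Union>l\<in>L. (\<lambda>x. x + l) -` K)" by auto
  moreover have "closed (\<Union>l\<in>L. (\<lambda>x. x + l) -` K)"
  proof (rule closed_Union_locally_finite[OF lc])
    show "closed ((\<lambda>x. x + l) -` K)" for l
      by (intro closed_vimage compact_imp_closed assms continuous_intros)
    fix Q :: "'a set" assume "compact Q"
    then have "finite (L \<inter> (\<lambda>(a, b). a - b) ` (K \<times> Q))"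
      by (intro locally_finite compact_minus assms)
    then show "finite {i \<in> L. (\<lambda>x. x + i) -` K \<inter> Q \<noteq> {}}"
      by (rule rev_finite_subset) (force simp: image_iff)
  qed
  ultimately show ?thesis by simp
qed

section \<open>The torus\<close>

lemma openin_torus: "openin (torus_topology L) A \<longleftrightarrow> A \<subseteq> torus L \<and> open {x. x +o L \<in> A}"
  by (simp add: torus_topology_def openin_quotient_topology torus_def)

lemma closedin_torus: "closedin (torus_topology L) A \<longleftrightarrow> A \<subseteq> torus L \<and> closed {x. x +o L \<in> A}"
proof -
  have "{x. x +o L \<in> torus L - A} = - {x. x +o L \<in> A}" by auto
  then show ?thesis
    by (auto simp: closedin_def openin_torus topspace_torus_topology closed_def)
qed

lemma openin_image:
  assumes "open U"
  shows "openin (torus_topology L) ((\<lambda>x. x +o L) ` U)"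
proof -
  have "{x. x +o L \<in> (\<lambda>x. x +o L) ` U} = (\<Union>l\<in>L. (+) l ` U)"
  proof (intro set_eqI iffI)
    fix x assume "x \<in> {x. x +o L \<in> (\<lambda>x. x +o L) ` U}"
    then obtain y where "y \<in> U" "y - x \<in> L" by (auto simp: coset_eq_iff)
    then show "x \<in> (\<Union>l\<in>L. (+) l ` U)"
      using minus_in[of "y - x"] by (auto intro!: bexI[of _ "x - y"] image_eqI[of _ _ y])
  next
    fix x assume "x \<in> (\<Union>l\<in>L. (+) l ` U)"
    then obtain l y where "l \<in> L" "y \<in> U" "x = l + y" by auto
    moreover from this have "x +o L = y +o L"
      unfolding coset_eq_iff using minus_in[of l] by simp
    ultimately show "x \<in> {x. x +o L \<in> (\<lambda>x. x +o L) ` U}" by blast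
  qed
  moreover have "open (\<Union>l\<in>L. (+) l ` U)"
    using open_translation[OF assms] by blast
  ultimately show ?thesis by (auto simp: openin_torus)
qed

lemma closedin_image:
  assumes "compact K"
  shows "closedin (torus_topology L) ((\<lambda>x. x +o L) ` K)"
proof -
  have "{x. x +o L \<in> (\<lambda>x. x +o L) ` K} = {x. \<exists>l\<in>L. x + l \<in> K}"
  proof (intro set_eqI iffI)
    fix x assume "x \<in> {x. x +o L \<in> (\<lambda>x. x +o L) ` K}"
    then obtain y where "y \<in> K" "y - x \<in> L" by (auto simp: coset_eq_iff)
    then show "x \<in> {x. \<exists>l\<in>L. x + l \<in> K}" by (auto intro!: bexI[of _ "y - x"])
  next
    fix x assume "x \<in> {x. \<exists>l\<in>L. x + l \<in> K}"
    then obtain l where "l \<in> L" "x + l \<in> K" by auto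
    moreover from this have "x +o L = (x + l) +o L"
      unfolding coset_eq_iff by simp
    ultimately show "x \<in> {x. x +o L \<in> (\<lambda>x. x +o L) ` K}" by blast
  qed
  then show ?thesis
    using closed_compact_plus[OF assms] by (auto simp: closedin_torus)
qed

lemma projection_measurable: "(\<lambda>x. x +o L) \<in> borel \<rightarrow>\<^sub>M borel_of (torus_topology L)"
  by (rule measurable_into_borel_of)
    (auto simp: topspace_torus_topology openin_torus vimage_def intro: borel_open)

text \<open>Countably many translates of a separating neighbourhood cover the group. Picking the
  representative in the first translate that meets the coset is measurable, because the projection is
  open. The section turns measurability on the torus, and on its product with another space, into
  measurability on the group itself.\<close>

lemma measurable_section:
  obtains s where "s \<in> borel_of (torus_topology L) \<rightarrow>\<^sub>M borel" "\<forall>c\<in>torus L. s c +o L = c"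
proof -
  obtain U where U: "open U" "0 \<in> U" "\<forall>a\<in>U. \<forall>b\<in>U. a - b \<in> L \<longrightarrow> a = b"
    by (rule separating_nhd)
  have "\<exists>F\<subseteq>range (\<lambda>y. (+) y ` U). countable F \<and> \<Union>F = \<Union>(range (\<lambda>y. (+) y ` U))"
    by (rule countable_subfamily) (simp add: open_translation[OF U(1)])
  then obtain F where F: "F \<subseteq> range (\<lambda>y. (+) y ` U)" "countable F"
      "\<Union>F = \<Union>(range (\<lambda>y. (+) y ` U))"
    by metis
  have FU: "\<Union>F = UNIV"
    unfolding F(3) using U(2) by force
  then have ne: "F \<noteq> {}" by auto
  define V where "V n = from_nat_into F n" for n
  have V: "\<exists>y. V n = (+) y ` U" for n
    using F(1) from_nat_into[OF ne, of n] unfolding V_def by blast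
  have openV: "open (V n)" for n using V[of n] open_translation[OF U(1)] by metis
  have injV: "a = b" if "a \<in> V n" "b \<in> V n" "a - b \<in> L" for a b n
    using V[of n] that U(3) by force
  have cover: "\<exists>n. x \<in> V n" for x
    using FU from_nat_into_surj[OF F(2)] by (metis UNIV_I UnionE V_def)
  define i where "i c = (LEAST n. c \<in> (\<lambda>x. x +o L) ` V n)" for c
  have i: "c \<in> (\<lambda>x. x +o L) ` V (i c)" if c: "c \<in> torus L" for c
  proof -
    obtain x where "c = x +o L" using c by (auto simp: torus_def)
    then have "\<exists>n. c \<in> (\<lambda>x. x +o L) ` V n" using cover[of x] by blast
    then show ?thesis unfolding i_def by (rule LeastI_ex)
  qed
  define s where "s c = (SOME x. x \<in> V (i c) \<and> x +o L = c)" for c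
  have s: "s c \<in> V (i c) \<and> s c +o L = c" if "c \<in> torus L" for c
  proof -
    have "\<exists>x. x \<in> V (i c) \<and> x +o L = c" using i[OF that] by (metis imageE)
    then show ?thesis unfolding s_def by (rule someI_ex)
  qed
  let ?T = "borel_of (torus_topology L)"
  have V_sets: "(\<lambda>x. x +o L) ` (V n \<inter> Q) \<in> sets ?T" if "open Q" for n Q
    by (intro openin_in_borel_of openin_image open_Int openV that)
  have i_meas: "i \<in> ?T \<rightarrow>\<^sub>M count_space UNIV"
    unfolding i_def
  proof (rule measurable_Least)
    fix n
    have "{c \<in> space ?T. c \<in> (\<lambda>x. x +o L) ` V n} = (\<lambda>x. x +o L) ` (V n \<inter> UNIV)"
      by (auto simp: topspace_torus_topology)
    then show "Measurable.pred ?T (\<lambda>c. c \<in> (\<lambda>x. x +o L) ` V n)"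
      unfolding pred_def using V_sets[of UNIV n] by simp
  qed
  have "s \<in> ?T \<rightarrow>\<^sub>M borel"
  proof (rule borel_measurableI)
    fix Q :: "'a set" assume Q: "open Q"
    have "s -` Q \<inter> space ?T = (\<Union>n. (i -` {n} \<inter> space ?T) \<inter> (\<lambda>x. x +o L) ` (V n \<inter> Q))"
    proof (intro set_eqI iffI)
      fix c assume "c \<in> s -` Q \<inter> space ?T"
      then show "c \<in> (\<Union>n. (i -` {n} \<inter> space ?T) \<inter> (\<lambda>x. x +o L) ` (V n \<inter> Q))"
        using s[of c] by (auto simp: topspace_torus_topology)
    next
      fix c assume "c \<in> (\<Union>n. (i -` {n} \<inter> space ?T) \<inter> (\<lambda>x. x +o L) ` (V n \<inter> Q))"
      then obtain x where x: "c = x +o L" "x \<in> V (i c)" "x \<in> Q" "c \<in> torus L"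
        by (auto simp: topspace_torus_topology)
      then have "s c = x"
        using s[of c] injV[of "s c" "i c" x] coset_eq_iff[of x "s c"] by auto
      then show "c \<in> s -` Q \<inter> space ?T" using x by (auto simp: topspace_torus_topology)
    qed
    also have "\<dots> \<in> sets ?T"
      using measurable_sets[OF i_meas] V_sets[OF Q] by (intro sets.countable_UN sets.Int) auto
    finally show "s -` Q \<inter> space ?T \<in> sets ?T" .
  qed
  with s show ?thesis by (intro that[of s]) auto
qed

end

section \<open>The vague topology\<close>

text \<open>A locally finite set is closed. So the points outside a Borel set \<open>A\<close> can be removed from the space
  to leave an open superset of \<open>A\<close> with the same mass, and finite subsets serve for inner regularity.
  The points are indexed by \<open>I\<close> rather than collected in a set, to allow multiplicities.\<close>

lemma regular_counting_measure:
  fixes p :: "'i \<Rightarrow> 'a::{t2_space,second_countable_topology}"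
  assumes lc: "locally_compact_space (euclidean :: 'a topology)"
    and fin: "\<And>K. compact K \<Longrightarrow> finite {i \<in> I. p i \<in> K}"
  shows "regular_borel_measure euclidean (distr (count_space I) borel p)"
    (is "regular_borel_measure euclidean ?m")
proof -
  have em: "emeasure ?m A = emeasure (count_space I) {i \<in> I. p i \<in> A}" if "A \<in> sets borel" for A
    using that by (subst emeasure_distr) (auto intro!: arg_cong2[where f = emeasure])
  have "emeasure ?m K < \<infinity>" if "compact K" for K
    using fin[OF that] by (subst em) (auto intro: borel_compact that simp: of_nat_less_top)
  moreover have "emeasure ?m A = (INF U\<in>{U. open U \<and> A \<subseteq> U}. emeasure ?m U)"
    if A: "A \<in> sets borel" for A
  proof (rule antisym)
    show "emeasure ?m A \<le> (INF U\<in>{U. open U \<and> A \<subseteq> U}. emeasure ?m U)"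
      by (rule INF_greatest) (auto intro!: emeasure_mono)
    have "closed (\<Union>i\<in>{i \<in> I. p i \<notin> A}. {p i})"
    proof (rule closed_Union_locally_finite[OF lc])
      fix Q :: "'a set" assume "compact Q"
      then show "finite {i \<in> {i \<in> I. p i \<notin> A}. {p i} \<inter> Q \<noteq> {}}"
        by (intro finite_subset[OF _ fin[of Q]]) auto
    qed simp
    then have o: "open (- (\<Union>i\<in>{i \<in> I. p i \<notin> A}. {p i}))" by (simp add: closed_def)
    have "emeasure ?m (- (\<Union>i\<in>{i \<in> I. p i \<notin> A}. {p i})) = emeasure ?m A"
      using A o by (subst (1 2) em) (auto intro!: arg_cong2[where f = emeasure])
    then show "(INF U\<in>{U. open U \<and> A \<subseteq> U}. emeasure ?m U) \<le> emeasure ?m A"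
      using o by (intro INF_lower2[of "- (\<Union>i\<in>{i \<in> I. p i \<notin> A}. {p i})"]) auto
  qed
  moreover have "emeasure ?m U = (SUP K\<in>{K. compact K \<and> K \<subseteq> U}. emeasure ?m K)"
    if U: "open U" for U
  proof (rule antisym)
    show "(SUP K\<in>{K. compact K \<and> K \<subseteq> U}. emeasure ?m K) \<le> emeasure ?m U"
      using U by (intro SUP_least) (auto intro!: emeasure_mono)
    have bound: "of_nat (card F) \<le> (SUP K\<in>{K. compact K \<and> K \<subseteq> U}. emeasure ?m K)"
      if F: "finite F" "F \<subseteq> {i \<in> I. p i \<in> U}" for F
    proof (rule SUP_upper2[of "p ` F"])
      show "p ` F \<in> {K. compact K \<and> K \<subseteq> U}"
        using F by (auto intro: finite_imp_compact)
      have "of_nat (card F) = emeasure (count_space I) F"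
        using F by (subst emeasure_count_space_finite) auto
      also have "\<dots> \<le> emeasure (count_space I) {i \<in> I. p i \<in> p ` F}"
        using F by (intro emeasure_mono) auto
      also have "\<dots> = emeasure ?m (p ` F)"
        using F by (intro em[symmetric] borel_closed finite_imp_closed) auto
      finally show "of_nat (card F) \<le> emeasure ?m (p ` F)" .
    qed
    show "emeasure ?m U \<le> (SUP K\<in>{K. compact K \<and> K \<subseteq> U}. emeasure ?m K)"
    proof (cases "finite {i \<in> I. p i \<in> U}")
      case True
      then have "emeasure ?m U = of_nat (card {i \<in> I. p i \<in> U})"
        using U by (subst em) (auto simp: emeasure_count_space_finite)
      then show ?thesis using bound[OF True subset_refl] by simp
    next
      case False
      have "of_nat n \<le> (SUP K\<in>{K. compact K \<and> K \<subseteq> U}. emeasure ?m K)" for n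
      proof -
        obtain F where "finite F" "card F = n" "F \<subseteq> {i \<in> I. p i \<in> U}"
          using infinite_arbitrarily_large[OF False, of n] by blast
        then show ?thesis using bound by blast
      qed
      then have "(SUP K\<in>{K. compact K \<and> K \<subseteq> U}. emeasure ?m K) = top"
        by (metis ennreal_Ex_less_of_nat infinity_ennreal_def leD top.not_eq_extremum)
      then show ?thesis by (metis top_greatest)
    qed
  qed
  ultimately show ?thesis
    unfolding regular_borel_measure_def by (simp add: sets_borel_of_euclidean)
qed

lemma regular_sets: "regular_borel_measure euclidean m \<Longrightarrow> sets m = sets borel"
  by (simp add: regular_borel_measure_def sets_borel_of_euclidean)

lemma regular_space:
  assumes "regular_borel_measure euclidean m"
  shows "space m = UNIV"
  using sets_eq_imp_space_eq[OF regular_sets[OF assms]] by simp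

lemma regular_compact_finite:
  "regular_borel_measure euclidean m \<Longrightarrow> compact K \<Longrightarrow> emeasure m K < \<infinity>"
  by (simp add: regular_borel_measure_def)

text \<open>Urysohn's lemma with compact support: the open set is first shrunk to one with compact closure.\<close>

lemma compact_support_function:
  fixes K U :: "'a::t2_space set"
  assumes lc: "locally_compact_space (euclidean :: 'a topology)"
    and K: "compact K" and U: "open U" "K \<subseteq> U"
  obtains f :: "'a \<Rightarrow> real" where "continuous_on UNIV f" "compact (closure {x. f x \<noteq> 0})"
    "\<forall>x. 0 \<le> f x \<and> f x \<le> 1" "\<forall>x\<in>K. f x = 1" "{x. f x \<noteq> 0} \<subseteq> U"
proof -
  have "\<forall>x\<in>K. \<exists>V C. open V \<and> x \<in> V \<and> V \<subseteq> C \<and> compact C"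
    using locally_compact_nhd[OF lc] by metis
  then obtain V C where VC: "\<And>x. x \<in> K \<Longrightarrow> open (V x) \<and> x \<in> V x \<and> V x \<subseteq> C x \<and> compact (C x)"
    by metis
  obtain D where D: "D \<subseteq> K" "finite D" "K \<subseteq> (\<Union>x\<in>D. V x)"
    using compactE_image[OF K, of K V] VC by (metis UN_I subsetI)
  define O' where "O' = U \<inter> (\<Union>x\<in>D. V x)"
  have O': "open O'" "K \<subseteq> O'" "O' \<subseteq> U"
    using VC D U by (auto simp: O'_def)
  have C: "compact (\<Union>x\<in>D. C x)" "O' \<subseteq> (\<Union>x\<in>D. C x)"
    using VC D by (auto simp: O'_def intro!: compact_UN)
  have cr: "completely_regular_space (euclidean :: 'a topology)"
    by (rule locally_compact_regular_imp_completely_regular_space[OF lc])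
      (auto simp: Hausdorff_space_def disjnt_def dest!: hausdorff)
  have K': "compactin euclidean K" "closedin euclidean (- O')" "disjnt K (- O')"
    using K O' by (auto simp: disjnt_def closed_def)
  obtain f where f: "continuous_map euclidean (top_of_set {0..1::real}) f"
      "f ` (- O') \<subseteq> {0}" "f ` K \<subseteq> {1}"
    by (rule Urysohn_completely_regular_compact_closed[OF zero_le_one cr K'])
  have supp: "{x. f x \<noteq> 0} \<subseteq> O'" using f(2) by auto
  show ?thesis
  proof
    show "continuous_on UNIV f"
      using f(1) continuous_map_into_fulltopology continuous_map_iff_continuous2
      by (metis subtopology_UNIV)
    have "closure {x. f x \<noteq> 0} \<subseteq> (\<Union>x\<in>D. C x)"
      using supp C by (intro closure_minimal compact_imp_closed) auto
    then show "compact (closure {x. f x \<noteq> 0})"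
      using C(1) by (metis closed_closure compact_Int_closed inf.absorb_iff2)
    show "\<forall>x. 0 \<le> f x \<and> f x \<le> 1"
      using continuous_map_image_subset_topspace[OF f(1)] by (simp add: image_subset_iff)
    show "\<forall>x\<in>K. f x = 1" using f(3) by auto
    show "{x. f x \<noteq> 0} \<subseteq> U" using supp O' by auto
  qed
qed

lemma integral_between_compact_and_open:
  fixes m :: "'a::t2_space measure" and f :: "'a \<Rightarrow> real"
  assumes m: "regular_borel_measure euclidean m"
    and f: "continuous_on UNIV f" "compact (closure {x. f x \<noteq> 0})" "\<forall>x. 0 \<le> f x \<and> f x \<le> 1"
  shows "K \<in> sets borel \<Longrightarrow> \<forall>x\<in>K. f x = 1 \<Longrightarrow> emeasure m K \<le> ennreal (\<integral>x. f x \<partial>m)"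
    and "U \<in> sets borel \<Longrightarrow> {x. f x \<noteq> 0} \<subseteq> U \<Longrightarrow> ennreal (\<integral>x. f x \<partial>m) \<le> emeasure m U"
proof -
  have meas: "f \<in> borel_measurable m"
    using borel_measurable_continuous_onI[OF f(1)]
    by (simp cong: measurable_cong_sets add: regular_sets[OF m])
  have "integrable m f"
  proof (rule integrableI_bounded_set[where A = "closure {x. f x \<noteq> 0}" and B = 1])
    show "AE x in m. x \<notin> closure {x. f x \<noteq> 0} \<longrightarrow> f x = 0"
      using closure_subset[of "{x. f x \<noteq> 0}"] by (intro AE_I2) blast
  qed (use f meas regular_compact_finite[OF m f(2)] regular_sets[OF m] in auto)
  then have eq: "(\<integral>\<^sup>+x. ennreal (f x) \<partial>m) = ennreal (\<integral>x. f x \<partial>m)"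
    using f(3) by (intro nn_integral_eq_integral) auto
  show "emeasure m K \<le> ennreal (\<integral>x. f x \<partial>m)" if "K \<in> sets borel" "\<forall>x\<in>K. f x = 1"
  proof -
    have "emeasure m K = (\<integral>\<^sup>+x. indicator K x \<partial>m)"
      using that(1) regular_sets[OF m] by simp
    also have "\<dots> \<le> (\<integral>\<^sup>+x. ennreal (f x) \<partial>m)"
      using that f(3) by (intro nn_integral_mono) (auto simp: indicator_def)
    finally show ?thesis using eq by simp
  qed
  show "ennreal (\<integral>x. f x \<partial>m) \<le> emeasure m U" if "U \<in> sets borel" "{x. f x \<noteq> 0} \<subseteq> U"
  proof -
    have "(\<integral>\<^sup>+x. ennreal (f x) \<partial>m) \<le> (\<integral>\<^sup>+x. indicator U x \<partial>m)"
      using that f(3) by (intro nn_integral_mono) (auto simp: indicator_def ennreal_le_1)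
    also have "\<dots> = emeasure m U"
      using that(1) regular_sets[OF m] by simp
    finally show ?thesis using eq by simp
  qed
qed

text \<open>Test functions squeezed between a compact set and an open set show that the integrals bound the
  mass of each compact subset of \<open>U\<close> for one measure by the mass of \<open>U\<close> for the other. Inner regularity
  gives equality on open sets, outer regularity on all Borel sets.\<close>

lemma regular_measure_eqI:
  fixes m m' :: "'a::t2_space measure"
  assumes lc: "locally_compact_space (euclidean :: 'a topology)"
    and m: "regular_borel_measure euclidean m" and m': "regular_borel_measure euclidean m'"
    and eq: "\<And>f :: 'a \<Rightarrow> real. continuous_on UNIV f \<Longrightarrow> compact (closure {x. f x \<noteq> 0}) \<Longrightarrow>
      (\<integral>x. f x \<partial>m) = (\<integral>x. f x \<partial>m')"
  shows "m = m'"
proof -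
  have le: "emeasure n U \<le> emeasure n' U"
    if n: "regular_borel_measure euclidean n" "regular_borel_measure euclidean n'"
    and eq: "\<And>f :: 'a \<Rightarrow> real. continuous_on UNIV f \<Longrightarrow> compact (closure {x. f x \<noteq> 0}) \<Longrightarrow>
      (\<integral>x. f x \<partial>n) = (\<integral>x. f x \<partial>n')" and U: "open U" for n n' and U :: "'a set"
  proof -
    have "emeasure n K \<le> emeasure n' U" if K: "compact K" "K \<subseteq> U" for K
    proof -
      obtain f :: "'a \<Rightarrow> real" where f: "continuous_on UNIV f" "compact (closure {x. f x \<noteq> 0})"
          "\<forall>x. 0 \<le> f x \<and> f x \<le> 1" "\<forall>x\<in>K. f x = 1" "{x. f x \<noteq> 0} \<subseteq> U"
        by (rule compact_support_function[OF lc K(1) U K(2)])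
      have "emeasure n K \<le> ennreal (\<integral>x. f x \<partial>n)"
        using integral_between_compact_and_open(1)[OF n(1) f(1-3)] f(4) K(1) by (simp add: borel_compact)
      also have "\<dots> \<le> emeasure n' U"
        using integral_between_compact_and_open(2)[OF n(2) f(1-3)] f(5) U eq[OF f(1,2)] by simp
      finally show ?thesis .
    qed
    then show ?thesis
      using n(1) U by (auto simp: regular_borel_measure_def intro!: SUP_least)
  qed
  have open_eq: "emeasure m U = emeasure m' U" if "open U" for U
    using le[OF m m' eq that] le[OF m' m eq[symmetric] that] by simp
  show ?thesis
  proof (rule measure_eqI)
    show "sets m = sets m'" using m m' by (simp add: regular_sets)
    fix A assume A: "A \<in> sets m"
    have "emeasure m A = (INF U\<in>{U. open U \<and> A \<subseteq> U}. emeasure m U)"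
      using m A by (simp add: regular_borel_measure_def)
    also have "\<dots> = (INF U\<in>{U. open U \<and> A \<subseteq> U}. emeasure m' U)"
      using open_eq by (intro INF_cong) auto
    also have "\<dots> = emeasure m' A"
      using m' A regular_sets[OF m] regular_sets[OF m'] by (simp add: regular_borel_measure_def)
    finally show "emeasure m A = emeasure m' A" .
  qed
qed

lemma openin_vague_integral:
  fixes f :: "'a::topological_space \<Rightarrow> real"
  assumes "continuous_on UNIV f" "compact (closure {x. f x \<noteq> 0})" "open U"
  shows "openin vague_topology {m. regular_borel_measure euclidean m \<and> (\<integral>x. f x \<partial>m) \<in> U}"
  unfolding vague_topology_def by (rule topology_generated_by_Basis) (use assms in blast)

lemma Hausdorff_vague_topology:
  assumes lc: "locally_compact_space (euclidean :: 'a::t2_space topology)"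
  shows "Hausdorff_space (vague_topology :: 'a measure topology)"
  unfolding Hausdorff_space_def topspace_vague_topology
proof (intro allI impI, clarify)
  fix m m' :: "'a measure"
  assume m: "regular_borel_measure euclidean m" "regular_borel_measure euclidean m'" "m \<noteq> m'"
  then obtain f :: "'a \<Rightarrow> real" where f: "continuous_on UNIV f" "compact (closure {x. f x \<noteq> 0})"
      "(\<integral>x. f x \<partial>m) \<noteq> (\<integral>x. f x \<partial>m')"
    using regular_measure_eqI[OF lc m(1,2)] by blast
  obtain U V where UV: "open U" "open V" "(\<integral>x. f x \<partial>m) \<in> U" "(\<integral>x. f x \<partial>m') \<in> V" "U \<inter> V = {}"
    using hausdorff[OF f(3)] by blast
  show "\<exists>U V. openin vague_topology U \<and> openin vague_topology V \<and> m \<in> U \<and> m' \<in> V \<and> disjnt U V"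
    using openin_vague_integral[OF f(1,2) UV(1)] openin_vague_integral[OF f(1,2) UV(2)] UV m
    by (intro exI[of _ "{m. regular_borel_measure euclidean m \<and> (\<integral>x. f x \<partial>m) \<in> U}"]
        exI[of _ "{m. regular_borel_measure euclidean m \<and> (\<integral>x. f x \<partial>m) \<in> V}"])
      (auto simp: disjnt_def)
qed

section \<open>Translation of measures\<close>

lemma translation_measurable: "(+) (g::'a::topological_ab_group_add) \<in> borel \<rightarrow>\<^sub>M borel"
  by (intro borel_measurable_continuous_onI continuous_intros)

lemma emeasure_measure_shift:
  fixes g :: "'a::topological_ab_group_add"
  assumes "sets m = sets borel" "A \<in> sets borel"
  shows "emeasure (measure_shift g m) A = emeasure m ((+) g -` A)"
  unfolding measure_shift_def
  using assms translation_measurable[of g] sets_eq_imp_space_eq[OF assms(1)]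
  by (subst emeasure_distr) (simp_all cong: measurable_cong_sets)

lemma vimage_translation:
  fixes g :: "'a::topological_ab_group_add"
  shows "(+) g -` A = (+) (- g) ` A"
  by (force simp: image_iff)

lemma regular_measure_shift:
  fixes g :: "'a::{topological_ab_group_add,t2_space}"
  assumes m: "regular_borel_measure euclidean m"
  shows "regular_borel_measure euclidean (measure_shift g m)"
proof -
  have ms: "sets (measure_shift g m) = sets borel" by (simp add: measure_shift_def)
  note em = emeasure_measure_shift[OF regular_sets[OF m]]
  have vim: "compact ((+) g -` K)" if "compact K" for K
    unfolding vimage_translation using that by (intro compact_continuous_image continuous_intros)
  have outer: "(\<lambda>U. (+) g -` U) ` {U. open U \<and> A \<subseteq> U} = {V. open V \<and> (+) g -` A \<subseteq> V}" for A :: "'a set"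
  proof (intro equalityI subsetI)
    fix V assume "V \<in> {V. open V \<and> (+) g -` A \<subseteq> V}"
    then have "open ((+) g ` V) \<and> A \<subseteq> (+) g ` V"
      using vimage_translation[of g A] by (auto intro: open_translation) (force simp: image_iff)
    then show "V \<in> (\<lambda>U. (+) g -` U) ` {U. open U \<and> A \<subseteq> U}"
      by (intro image_eqI[where x = "(+) g ` V"]) (simp_all add: inj_vimage_image_eq)
  qed (auto intro!: open_vimage continuous_intros)
  have inner: "(\<lambda>K. (+) g -` K) ` {K. compact K \<and> K \<subseteq> U} = {J. compact J \<and> J \<subseteq> (+) g -` U}" for U
  proof (intro equalityI subsetI)
    fix J assume "J \<in> {J. compact J \<and> J \<subseteq> (+) g -` U}"
    then have "compact ((+) g ` J) \<and> (+) g ` J \<subseteq> U"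
      by (auto intro!: compact_continuous_image continuous_intros)
    then show "J \<in> (\<lambda>K. (+) g -` K) ` {K. compact K \<and> K \<subseteq> U}"
      by (intro image_eqI[where x = "(+) g ` J"]) (simp_all add: inj_vimage_image_eq)
  qed (auto intro: vim)
  show ?thesis
    unfolding regular_borel_measure_def
  proof (intro conjI allI impI ballI)
    show "sets (measure_shift g m) = sets (borel_of euclidean)"
      by (simp add: ms sets_borel_of_euclidean)
  next
    fix K :: "'a set" assume "compactin euclidean K"
    then show "emeasure (measure_shift g m) K < \<infinity>"
      using regular_compact_finite[OF m vim[of K]] by (simp add: em borel_compact)
  next
    fix A assume "A \<in> sets (measure_shift g m)"
    then have A: "A \<in> sets borel" by (simp add: ms)
    have "(+) g -` A \<in> sets m"
      using measurable_sets[OF translation_measurable A, of g] regular_sets[OF m] by simp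
    then have "emeasure m ((+) g -` A) = (INF V\<in>{V. open V \<and> (+) g -` A \<subseteq> V}. emeasure m V)"
      using m by (simp add: regular_borel_measure_def)
    also have "\<dots> = (INF U\<in>{U. open U \<and> A \<subseteq> U}. emeasure m ((+) g -` U))"
      by (simp only: outer[symmetric] image_image)
    also have "\<dots> = (INF U\<in>{U. open U \<and> A \<subseteq> U}. emeasure (measure_shift g m) U)"
      by (intro INF_cong) (auto simp: em)
    finally show "emeasure (measure_shift g m) A =
        (INF U\<in>{U. openin euclidean U \<and> A \<subseteq> U}. emeasure (measure_shift g m) U)"
      using A by (simp add: em)
  next
    fix U :: "'a set" assume "openin euclidean U"
    then have U: "open U" by simp
    have "open ((+) g -` U)" using U by (intro open_vimage continuous_intros)
    then have "emeasure m ((+) g -` U) = (SUP J\<in>{J. compact J \<and> J \<subseteq> (+) g -` U}. emeasure m J)"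
      using m by (simp add: regular_borel_measure_def)
    also have "\<dots> = (SUP K\<in>{K. compact K \<and> K \<subseteq> U}. emeasure m ((+) g -` K))"
      by (simp only: inner[symmetric] image_image)
    also have "\<dots> = (SUP K\<in>{K. compact K \<and> K \<subseteq> U}. emeasure (measure_shift g m) K)"
      by (intro SUP_cong) (auto simp: em borel_compact)
    finally show "emeasure (measure_shift g m) U =
        (SUP K\<in>{K. compactin euclidean K \<and> K \<subseteq> U}. emeasure (measure_shift g m) K)"
      using U by (simp add: em)
  qed
qed

lemma continuous_measure_shift:
  fixes g :: "'a::{topological_ab_group_add,t2_space}"
  shows "continuous_map vague_topology vague_topology (measure_shift g)"
  unfolding vague_topology_def
proof (subst continuous_on_generated_topo_iff, fold vague_topology_def, intro conjI allI impI)
  fix S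
  assume "S \<in> {{m. regular_borel_measure euclidean m \<and> (\<integral>x. f x \<partial>m) \<in> U} | (f :: 'a \<Rightarrow> real) U.
        continuous_on UNIV f \<and> compact (closure {x. f x \<noteq> 0}) \<and> open U}"
  then obtain f :: "'a \<Rightarrow> real" and U where f: "continuous_on UNIV f"
      "compact (closure {x. f x \<noteq> 0})" "open U"
    and S: "S = {m. regular_borel_measure euclidean m \<and> (\<integral>x. f x \<partial>m) \<in> U}"
    by blast
  have cont: "continuous_on UNIV (\<lambda>x. f (g + x))"
    by (intro continuous_on_compose2[OF f(1)] continuous_intros) auto
  have "closure {x. f (g + x) \<noteq> 0} \<subseteq> (+) (- g) ` closure {x. f x \<noteq> 0}"
  proof (rule closure_minimal)
    show "{x. f (g + x) \<noteq> 0} \<subseteq> (+) (- g) ` closure {x. f x \<noteq> 0}"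
      using closure_subset[of "{x. f x \<noteq> 0}"] by (force simp: vimage_translation[symmetric])
    show "closed ((+) (- g) ` closure {x. f x \<noteq> 0})"
      unfolding vimage_translation[symmetric] by (intro closed_vimage continuous_intros) auto
  qed
  moreover have "compact ((+) (- g) ` closure {x. f x \<noteq> 0})"
    by (intro compact_continuous_image f continuous_intros)
  ultimately have cpt: "compact (closure {x. f (g + x) \<noteq> 0})"
    by (metis closed_closure compact_Int_closed inf.absorb_iff2)
  have "(\<integral>x. f x \<partial>measure_shift g m) = (\<integral>x. f (g + x) \<partial>m)" if "regular_borel_measure euclidean m" for m
    unfolding measure_shift_def
    using translation_measurable[of g] borel_measurable_continuous_onI[OF f(1)] regular_sets[OF that]
    by (intro integral_distr) (simp_all cong: measurable_cong_sets)
  then have "measure_shift g -` S \<inter> topspace vague_topology =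
      {m. regular_borel_measure euclidean m \<and> (\<integral>x. f (g + x) \<partial>m) \<in> U}"
    by (auto simp: S topspace_vague_topology regular_measure_shift)
  then show "openin vague_topology (measure_shift g -` S \<inter> topspace vague_topology)"
    using openin_vague_integral[OF cont cpt f(3)] by simp
next
  have "measure_shift g ` topspace vague_topology \<subseteq> topspace vague_topology"
    by (auto simp: topspace_vague_topology regular_measure_shift)
  then show "measure_shift g ` topspace vague_topology \<subseteq> \<Union> {{m. regular_borel_measure euclidean m \<and> (\<integral>x. f x \<partial>m) \<in> U} | (f :: 'a \<Rightarrow> real) U.
        continuous_on UNIV f \<and> compact (closure {x. f x \<noteq> 0}) \<and> open U}"
    unfolding topology_generated_by_topspace[symmetric] vague_topology_def .
qed

section \<open>Haar measure and generic points\<close>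

locale haar_group =
  fixes \<mu> :: "'h::{topological_ab_group_add,t2_space,second_countable_topology} measure"
  assumes lc: "locally_compact_space (euclidean :: 'h topology)"
    and haar: "haar_measure euclidean \<mu>"
begin

lemma regular: "regular_borel_measure euclidean \<mu>"
  using haar by (simp add: haar_measure_def)

lemma sets_\<mu> [simp, measurable_cong]: "sets \<mu> = sets borel"
  by (rule regular_sets[OF regular])

lemma space_\<mu> [simp]: "space \<mu> = UNIV"
  by (rule regular_space[OF regular])

lemma emeasure_UNIV_nonzero: "emeasure \<mu> UNIV \<noteq> 0"
  using haar by (simp add: haar_measure_def)

lemma translation_sets: "A \<in> sets borel \<Longrightarrow> (\<lambda>h. h + t) -` A \<in> sets borel"
  for t :: 'h
proof -
  assume A: "A \<in> sets borel"
  have "(\<lambda>h::'h. h + t) \<in> borel \<rightarrow>\<^sub>M borel"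
    by (intro borel_measurable_continuous_onI continuous_intros)
  from measurable_sets[OF this A] show ?thesis by simp
qed

lemma emeasure_translation:
  assumes "A \<in> sets borel"
  shows "emeasure \<mu> ((\<lambda>h. h + t) -` A) = emeasure \<mu> A"
proof -
  have "emeasure \<mu> ((+) (- t) ` A) = emeasure \<mu> A"
    using haar assms by (simp add: haar_measure_def del: uminus_add_conv_diff)
  moreover have "(\<lambda>h. h + t) -` A = (+) (- t) ` A"
    by (force simp: image_iff)
  ultimately show ?thesis by simp
qed

text \<open>Stated with the mass of the difference, so that no subtraction of masses is needed later.\<close>

lemma outer_approximation:
  assumes A: "A \<in> sets borel" and fin: "emeasure \<mu> A < \<infinity>" and \<epsilon>: "0 < (\<epsilon> :: ennreal)"
  shows "\<exists>U. open U \<and> A \<subseteq> U \<and> emeasure \<mu> (U - A) < \<epsilon>"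
proof -
  have "(INF U\<in>{U. open U \<and> A \<subseteq> U}. emeasure \<mu> U) = emeasure \<mu> A"
    using regular A by (simp add: regular_borel_measure_def)
  also have "emeasure \<mu> A < emeasure \<mu> A + \<epsilon>"
    using fin \<epsilon> by (cases "emeasure \<mu> A"; cases \<epsilon>) (auto simp flip: ennreal_plus simp: ennreal_lessI)
  finally obtain U where U: "open U" "A \<subseteq> U" "emeasure \<mu> U < emeasure \<mu> A + \<epsilon>"
    by (auto simp: INF_less_iff)
  have "emeasure \<mu> U = emeasure \<mu> A + emeasure \<mu> (U - A)"
    using U A by (subst plus_emeasure) (auto intro!: arg_cong2[where f = emeasure])
  with U(3) have "emeasure \<mu> (U - A) < \<epsilon>" by (simp add: ennreal_add_left_cancel_less)
  with U show ?thesis by blast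
qed

lemma inner_approximation:
  assumes A: "A \<in> sets borel" and R: "A \<subseteq> R" "compact R" and \<epsilon>: "0 < (\<epsilon> :: ennreal)"
  shows "\<exists>K. compact K \<and> K \<subseteq> A \<and> emeasure \<mu> (A - K) < \<epsilon>"
proof -
  \<comment> \<open>The complement in \<open>R\<close> of an open set that barely exceeds \<open>R - A\<close> is the required compact set.\<close>
  have "emeasure \<mu> (R - A) \<le> emeasure \<mu> R"
    using R by (intro emeasure_mono) (auto intro: borel_compact)
  then have fin: "emeasure \<mu> (R - A) < \<infinity>"
    using regular_compact_finite[OF regular R(2)] by (rule le_less_trans)
  have "R - A \<in> sets borel" using A borel_compact[OF R(2)] by auto
  from outer_approximation[OF this fin \<epsilon>]
  obtain U where U: "open U" "R - A \<subseteq> U" "emeasure \<mu> (U - (R - A)) < \<epsilon>" by blast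
  have "emeasure \<mu> (A - (R - U)) \<le> emeasure \<mu> (U - (R - A))"
    using R U A borel_compact[OF R(2)] borel_open[OF U(1)] by (intro emeasure_mono) auto
  with U R show ?thesis
    by (intro exI[of _ "R - U"]) (auto intro: compact_diff)
qed

text \<open>Sandwich the window between a compact \<open>K\<close> and an open \<open>U\<close>. By compactness \<open>K + t\<close> stays in \<open>U\<close> for
  all small \<open>t\<close>, so a point of \<open>W\<close> that \<open>t\<close> moves out of \<open>W\<close> lies in \<open>W - K\<close> or is moved into \<open>U - W\<close>.
  Points that \<open>t\<close> moves into \<open>W\<close> are the points that \<open>-t\<close> moves out of it, translated.\<close>

lemma translation_continuity:
  assumes W: "W \<in> sets borel" "compact (closure W)" and \<epsilon>: "0 < \<epsilon>"
  shows "\<exists>N. open N \<and> 0 \<in> N \<and> (\<forall>t\<in>N. emeasure \<mu> {h. (h + t \<in> W) \<noteq> (h \<in> W)} \<le> (\<epsilon> + \<epsilon>) + (\<epsilon> + \<epsilon>))"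
proof -
  have "emeasure \<mu> W \<le> emeasure \<mu> (closure W)"
    using closure_subset by (intro emeasure_mono) auto
  then have fin: "emeasure \<mu> W < \<infinity>"
    using regular_compact_finite[OF regular W(2)] by (rule le_less_trans)
  obtain U where U: "open U" "W \<subseteq> U" "emeasure \<mu> (U - W) < \<epsilon>"
    using outer_approximation[OF W(1) fin \<epsilon>] by blast
  obtain K where K: "compact K" "K \<subseteq> W" "emeasure \<mu> (W - K) < \<epsilon>"
    using inner_approximation[OF W(1) closure_subset W(2) \<epsilon>] by blast
  have K': "K \<in> sets borel" and U': "U \<in> sets borel" using U K by (auto intro: borel_compact)
  \<comment> \<open>Both signs of \<open>t\<close> are controlled at once, since \<open>- t\<close> is used for points that enter the window.\<close>
  let ?O = "(\<lambda>(t, k). k + t) -` U \<inter> (\<lambda>(t, k). k + - t) -` U"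
  have "open ?O"
    by (intro open_Int open_vimage U(1))
      (auto simp: case_prod_unfold simp del: add_uminus_conv_diff intro!: continuous_intros)
  moreover have "{0} \<times> K \<subseteq> ?O" using K(2) U(2) by auto
  ultimately have "\<exists>N. 0 \<in> N \<and> open N \<and> N \<times> K \<subseteq> ?O"
    by (rule Elementary_Topology.tube_lemma[OF K(1)])
  then obtain N where N: "0 \<in> N" "open N" "N \<times> K \<subseteq> ?O" by metis
  have bound: "emeasure \<mu> {h. h \<in> W \<and> h + t \<notin> W} \<le> \<epsilon> + \<epsilon>" if "\<forall>k\<in>K. k + t \<in> U" for t
  proof -
    have "emeasure \<mu> {h. h \<in> W \<and> h + t \<notin> W} \<le> emeasure \<mu> ((W - K) \<union> (\<lambda>h. h + t) -` (U - W))"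
      using that W(1) K' U' by (intro emeasure_mono) (auto intro!: translation_sets sets.Un sets.Diff)
    also have "\<dots> \<le> emeasure \<mu> (W - K) + emeasure \<mu> ((\<lambda>h. h + t) -` (U - W))"
      using W(1) K' U' by (intro emeasure_subadditive) (auto intro!: translation_sets)
    also have "\<dots> = emeasure \<mu> (W - K) + emeasure \<mu> (U - W)"
      using W(1) U' by (simp add: emeasure_translation)
    also have "\<dots> \<le> \<epsilon> + \<epsilon>" using U(3) K(3) by (intro add_mono) auto
    finally show ?thesis .
  qed
  have meas: "{h. h \<in> W \<and> h + t \<notin> W} \<in> sets borel" for t
  proof -
    have "{h. h \<in> W \<and> h + t \<notin> W} = W - (\<lambda>h. h + t) -` W" by auto
    then show ?thesis using W(1) translation_sets[of W t] by auto
  qed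
  have "emeasure \<mu> {h. (h + t \<in> W) \<noteq> (h \<in> W)} \<le> (\<epsilon> + \<epsilon>) + (\<epsilon> + \<epsilon>)" if t: "t \<in> N" for t
  proof -
    have U: "\<forall>k\<in>K. k + t \<in> U" "\<forall>k\<in>K. k + - t \<in> U" using N(3) t by auto
    have "{h. (h + t \<in> W) \<noteq> (h \<in> W)} =
        {h. h \<in> W \<and> h + t \<notin> W} \<union> (\<lambda>h. h + t) -` {h. h \<in> W \<and> h + - t \<notin> W}"
      by auto
    also have "emeasure \<mu> \<dots> \<le> emeasure \<mu> {h. h \<in> W \<and> h + t \<notin> W} +
        emeasure \<mu> ((\<lambda>h. h + t) -` {h. h \<in> W \<and> h + - t \<notin> W})"
      using meas[of t] translation_sets[OF meas[of "- t"], of t]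
      by (intro emeasure_subadditive) simp_all
    also have "\<dots> = emeasure \<mu> {h. h \<in> W \<and> h + t \<notin> W} + emeasure \<mu> {h. h \<in> W \<and> h + - t \<notin> W}"
      using emeasure_translation[OF meas[of "- t"], of t] by simp
    also have "\<dots> \<le> (\<epsilon> + \<epsilon>) + (\<epsilon> + \<epsilon>)"
      by (intro add_mono bound U)
    finally show ?thesis .
  qed
  with N show ?thesis by blast
qed

sublocale sigma_finite_measure \<mu>
proof
  obtain R :: "nat \<Rightarrow> 'h set" where R: "\<forall>n. compact (R n)" "(\<Union>n. R n) = UNIV"
    using sigma_compact[OF lc] .
  show "\<exists>A. countable A \<and> A \<subseteq> sets \<mu> \<and> \<Union> A = space \<mu> \<and> (\<forall>a\<in>A. emeasure \<mu> a \<noteq> \<infinity>)"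
    using R regular_compact_finite[OF regular]
    by (intro exI[of _ "range R"]) (auto intro: borel_compact simp: less_top)
qed

text \<open>For a fixed \<open>x\<close>, choose \<open>d n x\<close> in \<open>D\<close> so close to \<open>x\<close> that the set of all \<open>h\<close> for which membership of
  \<open>h + d n x\<close> and of \<open>h + x\<close> in the window differ has mass at most \<open>4 / 2 ^ n\<close>. By Borel and Cantelli
  almost every \<open>h\<close> lies in only finitely many of these sets. Taking for \<open>d n x\<close> the first suitable element
  in an enumeration of \<open>D\<close> makes it measurable in \<open>x\<close>, so that Fubini's theorem exchanges the quantifiers.\<close>

lemma dense_translates_approximate:
  fixes W D :: "'h set"
  assumes W [measurable]: "W \<in> sets borel" and cW: "compact (closure W)"
    and D: "countable D" "closure D = UNIV"
  obtains d :: "nat \<Rightarrow> 'h \<Rightarrow> 'h" where "\<forall>n x. d n x \<in> D"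
    "AE h in \<mu>. AE x in \<mu>. \<forall>\<^sub>F n in sequentially. (h + d n x \<in> W) = (h + x \<in> W)"
proof -
  define \<epsilon> where "\<epsilon> n = ennreal ((1/2) ^ n)" for n :: nat
  have "\<forall>n. \<exists>N. open N \<and> 0 \<in> N \<and>
      (\<forall>t\<in>N. emeasure \<mu> {h. (h + t \<in> W) \<noteq> (h \<in> W)} \<le> (\<epsilon> n + \<epsilon> n) + (\<epsilon> n + \<epsilon> n))"
    by (intro allI translation_continuity W cW) (simp add: \<epsilon>_def)
  from choice[OF this] obtain N where N': "\<forall>n. open (N n) \<and> 0 \<in> N n \<and>
      (\<forall>t\<in>N n. emeasure \<mu> {h. (h + t \<in> W) \<noteq> (h \<in> W)} \<le> (\<epsilon> n + \<epsilon> n) + (\<epsilon> n + \<epsilon> n))" ..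
  have N: "open (N n)" "0 \<in> N n" "t \<in> N n \<Longrightarrow>
      emeasure \<mu> {h. (h + t \<in> W) \<noteq> (h \<in> W)} \<le> (\<epsilon> n + \<epsilon> n) + (\<epsilon> n + \<epsilon> n)" for n t
    using N' by auto
  have "D \<noteq> {}" using D(2) by auto
  define e where "e = from_nat_into D"
  have e: "e j \<in> D" for j using \<open>D \<noteq> {}\<close> by (simp add: e_def from_nat_into)
  have dense: "\<exists>j. e j - x \<in> N n" for n x
  proof -
    have "open ((+) x ` N n)" by (rule open_translation[OF N(1)])
    moreover have "x \<in> (+) x ` N n" using N(2)[of n] by force
    ultimately obtain y where "y \<in> D" "y \<in> (+) x ` N n"
      using D(2) open_Int_closure_eq_empty[of "(+) x ` N n" D] by auto
    moreover obtain j where "e j = y"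
      using from_nat_into_surj[OF D(1) \<open>y \<in> D\<close>] by (auto simp: e_def)
    ultimately show ?thesis by (intro exI[of _ j]) auto
  qed
  define i where "i n x = (LEAST j. e j - x \<in> N n)" for n x
  define d where "d n x = e (i n x)" for n x
  have dN: "d n x - x \<in> N n" for n x
    unfolding d_def i_def using LeastI_ex[OF dense] by simp
  have [measurable]: "i n \<in> borel \<rightarrow>\<^sub>M count_space UNIV" for n
    unfolding i_def
  proof (rule measurable_Least)
    fix j
    have "open ((\<lambda>x. e j + - x) -` N n)" by (intro open_vimage N continuous_intros)
    moreover have "{x \<in> space borel. e j - x \<in> N n} = (\<lambda>x. e j + - x) -` N n" by auto
    ultimately show "Measurable.pred borel (\<lambda>x. e j - x \<in> N n)"
      unfolding pred_def using borel_open by metis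
  qed
  have [measurable]: "e \<in> count_space UNIV \<rightarrow>\<^sub>M borel" by simp
  have dm [measurable]: "d n \<in> borel \<rightarrow>\<^sub>M borel" for n
    unfolding d_def by measurable
  have "AE h in \<mu>. \<forall>\<^sub>F n in sequentially. (h + d n x \<in> W) = (h + x \<in> W)" for x
  proof -
    define B where "B n = {h. (h + d n x \<in> W) \<noteq> (h + x \<in> W)}" for n
    have B: "B n = (\<lambda>h. h + x) -` {h. (h + (d n x - x) \<in> W) \<noteq> (h \<in> W)}" for n
      by (auto simp: B_def algebra_simps)
    have S: "{h. (h + t \<in> W) \<noteq> (h \<in> W)} \<in> sets borel" for t
    proof -
      have "{h. (h + t \<in> W) \<noteq> (h \<in> W)} = sym_diff ((\<lambda>h. h + t) -` W) W" by auto
      then show ?thesis using W translation_sets[OF W, of t] by auto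
    qed
    have "emeasure \<mu> (B n) \<le> (\<epsilon> n + \<epsilon> n) + (\<epsilon> n + \<epsilon> n)" for n
      unfolding B emeasure_translation[OF S] by (rule N(3)[OF dN])
    also have "(\<epsilon> n + \<epsilon> n) + (\<epsilon> n + \<epsilon> n) = ennreal (4 * (1/2) ^ n)" for n
      by (simp add: \<epsilon>_def flip: ennreal_plus)
    finally have le: "emeasure \<mu> (B n) \<le> ennreal (4 * (1/2) ^ n)" for n .
    have "AE h in \<mu>. \<forall>\<^sub>F n in sequentially. h \<in> space \<mu> - B n"
    proof (rule borel_cantelli_AE1)
      show "B n \<in> sets \<mu>" for n unfolding B sets_\<mu> by (rule translation_sets[OF S])
      show "emeasure \<mu> (B n) < \<infinity>" for n
        using le_less_trans[OF le[of n] ennreal_less_top] by simp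
      have bd: "measure \<mu> (B n) \<le> 4 * (1/2) ^ n" for n
        unfolding measure_def using le[of n] by (intro enn2real_leI) auto
      have "summable (\<lambda>n. 4 * (1/2 :: real) ^ n)"
        by (intro summable_mult summable_geometric) simp
      then show "summable (\<lambda>n. measure \<mu> (B n))"
        by (rule summable_comparison_test'[where N = 0]) (simp only: real_norm_def abs_of_nonneg[OF measure_nonneg] bd)
    qed
    then show ?thesis by (simp add: B_def)
  qed
  then have "AE x in \<mu>. AE h in \<mu>. \<forall>\<^sub>F n in sequentially. (h + d n x \<in> W) = (h + x \<in> W)"
    by simp
  moreover have "pair_sigma_finite \<mu> \<mu>" ..
  moreover have "{z \<in> space (\<mu> \<Otimes>\<^sub>M \<mu>).
      \<forall>\<^sub>F n in sequentially. (fst z + d n (snd z) \<in> W) = (fst z + snd z \<in> W)} \<in> sets (\<mu> \<Otimes>\<^sub>M \<mu>)"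
    unfolding eventually_sequentially by measurable
  ultimately have "AE h in \<mu>. AE x in \<mu>. \<forall>\<^sub>F n in sequentially. (h + d n x \<in> W) = (h + x \<in> W)"
    by (subst pair_sigma_finite.AE_commute) auto
  then show ?thesis
    using e by (intro that[of d]) (auto simp: d_def)
qed

text \<open>If \<open>h\<close> and \<open>h'\<close> satisfy the conclusion of the previous lemma and visit the window along the same
  elements of \<open>D\<close>, then \<open>W - h\<close> and \<open>W - h'\<close> have the same limit description and agree up to a null set.
  Haar aperiodicity then forces \<open>h = h'\<close>. Intersecting the countably many translates by \<open>D\<close> makes the
  set of such points stable under \<open>D\<close>.\<close>

lemma generic_points:
  fixes W D :: "'h set"
  assumes W: "W \<in> sets borel" "compact (closure W)"
    and D: "countable D" "closure D = UNIV" "0 \<in> D" "\<And>a b. a \<in> D \<Longrightarrow> b \<in> D \<Longrightarrow> a + b \<in> D"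
    and ap: "haar_aperiodic \<mu> W"
  obtains E where "E \<in> sets borel" "emeasure \<mu> (- E) = 0" "\<forall>h\<in>E. \<forall>d\<in>D. h + d \<in> E"
    "\<forall>h\<in>E. \<forall>h'\<in>E. (\<forall>d\<in>D. (h + d \<in> W) = (h' + d \<in> W)) \<longrightarrow> h = h'"
proof -
  obtain d :: "nat \<Rightarrow> 'h \<Rightarrow> 'h" where d: "\<forall>n x. d n x \<in> D"
    "AE h in \<mu>. AE x in \<mu>. \<forall>\<^sub>F n in sequentially. (h + d n x \<in> W) = (h + x \<in> W)"
    by (rule dense_translates_approximate[OF W D(1,2)])
  obtain N where N: "{h \<in> space \<mu>. \<not> (AE x in \<mu>. \<forall>\<^sub>F n in sequentially. (h + d n x \<in> W) = (h + x \<in> W))} \<subseteq> N"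
      "N \<in> null_sets \<mu>"
    using d(2) unfolding eventually_ae_filter by blast
  \<comment> \<open>\<open>N\<close> is a measurable null set containing the exceptional points, all of whose translates by \<open>D\<close> are removed.\<close>
  define E where "E = - (\<Union>a\<in>D. (\<lambda>h. h + a) -` N)"
  have null: "(\<Union>a\<in>D. (\<lambda>h. h + a) -` N) \<in> null_sets \<mu>"
    using N(2) by (intro null_sets_UN' D(1)) (auto simp: null_sets_def translation_sets emeasure_translation)
  show ?thesis
  proof
    show "E \<in> sets borel"
      unfolding E_def using null_setsD2[OF null] unfolding sets_\<mu> by (rule borel_comp)
    show "emeasure \<mu> (- E) = 0" unfolding E_def double_complement by (rule null_setsD1[OF null])
    show "\<forall>h\<in>E. \<forall>d\<in>D. h + d \<in> E" using D(4) by (auto simp: E_def add.assoc)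
    show "\<forall>h\<in>E. \<forall>h'\<in>E. (\<forall>d\<in>D. (h + d \<in> W) = (h' + d \<in> W)) \<longrightarrow> h = h'"
    proof (intro ballI impI)
      fix h h' assume "h \<in> E" "h' \<in> E" and eq: "\<forall>d\<in>D. (h + d \<in> W) = (h' + d \<in> W)"
      then have "h \<notin> N" "h' \<notin> N" using D(3) by (auto simp: E_def)
      then have "AE x in \<mu>. \<forall>\<^sub>F n in sequentially. (h + d n x \<in> W) = (h + x \<in> W)"
        "AE x in \<mu>. \<forall>\<^sub>F n in sequentially. (h' + d n x \<in> W) = (h' + x \<in> W)"
        using N(1) by auto
      then have "AE x in \<mu>. (h + x \<in> W) = (h' + x \<in> W)"
      proof eventually_elim
        case (elim x)
        then have "\<forall>\<^sub>F n in sequentially. (h + x \<in> W) = (h' + x \<in> W)"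
          by eventually_elim (use eq d(1) in auto)
        then show ?case by simp
      qed
      moreover have meas: "sym_diff ((\<lambda>x. x + h) -` W) ((\<lambda>x. x + h') -` W) \<in> sets borel"
        using translation_sets[OF W(1), of h] translation_sets[OF W(1), of h'] by auto
      ultimately have "emeasure \<mu> (sym_diff ((\<lambda>x. x + h) -` W) ((\<lambda>x. x + h') -` W)) = 0"
        by (subst (asm) AE_iff_measurable[where N = "sym_diff ((\<lambda>x. x + h) -` W) ((\<lambda>x. x + h') -` W)"])
          (auto simp: add.commute)
      then have "emeasure \<mu> ((\<lambda>x. x + - h) -` sym_diff ((\<lambda>x. x + h) -` W) ((\<lambda>x. x + h') -` W)) = 0"
        by (subst emeasure_translation[OF meas])
      moreover have "(\<lambda>x. x + - h) -` sym_diff ((\<lambda>x. x + h) -` W) ((\<lambda>x. x + h') -` W) =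
          sym_diff ((\<lambda>w. (h - h') + w) ` W) W"
      proof -
        have "(\<lambda>x. x + - h) -` ((\<lambda>x. x + h') -` W) = (\<lambda>w. (h - h') + w) ` W"
          by (auto simp: algebra_simps intro!: image_eqI[of _ _ "_ + h' - h"])
        moreover have "(\<lambda>x. x + - h) -` ((\<lambda>x. x + h) -` W) = W" by auto
        ultimately show ?thesis by (simp add: vimage_Diff vimage_Un) blast
      qed
      ultimately have "emeasure \<mu> (sym_diff ((\<lambda>w. (h - h') + w) ` W) W) = 0" by simp
      then have "h - h' = 0" using ap unfolding haar_aperiodic_def by blast
      then show "h = h'" by simp
    qed
  qed
qed

section \<open>Countably many Borel sets made clopen on large compact sets\<close>

text \<open>Lusin's argument for the indicator functions of all \<open>A i\<close> at once: approximate \<open>R \<inter> A i\<close> and \<open>R - A i\<close>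
  from inside by compact sets, with errors that are summable in \<open>i\<close>. On the intersection of these unions
  of two disjoint compact sets, each \<open>A i\<close> is relatively clopen.\<close>

lemma compact_clopen_pieces:
  fixes A :: "nat \<Rightarrow> 'h set" and c :: real
  assumes A: "\<And>i. A i \<in> sets borel" and E: "E \<in> sets borel" "emeasure \<mu> (- E) = 0"
    and R: "compact R" and c: "0 < c"
  shows "\<exists>C. compact C \<and> C \<subseteq> E \<and> emeasure \<mu> (R - C) \<le> ennreal (3 * c) \<and>
    (\<forall>i. \<forall>h\<in>C. \<exists>B. open B \<and> h \<in> B \<and> (\<forall>h'\<in>B \<inter> C. (h' \<in> A i) = (h \<in> A i)))"
proof -
  have Rb: "R \<in> sets borel" using R by (rule borel_compact)
  define e where "e i = ennreal (c * (1/2) ^ Suc i)" for i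
  have e: "0 < e i" for i using c by (simp add: e_def)
  have "\<forall>i. \<exists>K. compact K \<and> K \<subseteq> R \<inter> A i \<and> emeasure \<mu> ((R \<inter> A i) - K) < e i"
    using A R Rb e by (intro allI inner_approximation[of _ R]) auto
  then obtain K where K: "\<And>i. compact (K i)" "\<And>i. K i \<subseteq> R \<inter> A i"
      "\<And>i. emeasure \<mu> ((R \<inter> A i) - K i) < e i" by metis
  have "\<forall>i. \<exists>K. compact K \<and> K \<subseteq> R - A i \<and> emeasure \<mu> ((R - A i) - K) < e i"
    using A R Rb e by (intro allI inner_approximation[of _ R]) auto
  then obtain J where J: "\<And>i. compact (J i)" "\<And>i. J i \<subseteq> R - A i"
      "\<And>i. emeasure \<mu> ((R - A i) - J i) < e i" by metis
  have "\<exists>K. compact K \<and> K \<subseteq> R \<inter> E \<and> emeasure \<mu> ((R \<inter> E) - K) < ennreal c"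
    using E R Rb c by (intro inner_approximation[of _ R]) auto
  then obtain I where I: "compact I" "I \<subseteq> R \<inter> E" "emeasure \<mu> ((R \<inter> E) - I) < ennreal c" by metis
  define C where "C = I \<inter> (\<Inter>i. K i \<union> J i)"
  have b: "K i \<in> sets borel" "J i \<in> sets borel" "I \<in> sets borel" for i
    using K J I by (auto intro: borel_compact)
  have "compact C"
    unfolding C_def
    by (intro compact_Int_closed closed_INT closed_Un ballI compact_imp_closed I K(1) J(1))
  moreover have "C \<subseteq> E" using I by (auto simp: C_def)
  moreover have "emeasure \<mu> (R - C) \<le> ennreal (3 * c)"
  proof -
    define S where "S i = (R \<inter> A i - K i) \<union> ((R - A i) - J i)" for i
    have Sb: "S i \<in> sets borel" for i using A[of i] Rb b by (auto simp: S_def)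
    have "emeasure \<mu> (S i) \<le> ennreal (2 * c * (1/2) ^ Suc i)" for i
    proof -
      have "emeasure \<mu> (S i) \<le> emeasure \<mu> (R \<inter> A i - K i) + emeasure \<mu> ((R - A i) - J i)"
        unfolding S_def using A[of i] Rb b by (intro emeasure_subadditive) auto
      also have "\<dots> \<le> e i + e i" using K(3)[of i] J(3)[of i] by (intro add_mono) auto
      also have "\<dots> = ennreal (2 * c * (1/2) ^ Suc i)"
        using c by (simp add: e_def flip: ennreal_plus)
      finally show ?thesis .
    qed
    then have "(\<Sum>i. emeasure \<mu> (S i)) \<le> (\<Sum>i. ennreal (2 * c * (1/2) ^ Suc i))"
      by (intro suminf_le) auto
    also have "\<dots> = ennreal (2 * c)"
      using sums_mult[OF power_half_series, of "2 * c"] c by (intro suminf_ennreal_eq) auto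
    finally have sum: "(\<Sum>i. emeasure \<mu> (S i)) \<le> ennreal (2 * c)" .
    have "R - C \<subseteq> - E \<union> ((R \<inter> E) - I) \<union> (\<Union>i. S i)"
      by (auto simp: C_def S_def)
    then have "emeasure \<mu> (R - C) \<le> emeasure \<mu> (- E \<union> ((R \<inter> E) - I) \<union> (\<Union>i. S i))"
      using E Rb b Sb by (intro emeasure_mono) (auto intro!: sets.Un)
    also have "\<dots> \<le> emeasure \<mu> (- E \<union> ((R \<inter> E) - I)) + emeasure \<mu> (\<Union>i. S i)"
      using E Rb b Sb by (intro emeasure_subadditive) (auto intro!: sets.Un)
    also have "\<dots> \<le> (emeasure \<mu> (- E) + emeasure \<mu> ((R \<inter> E) - I)) + (\<Sum>i. emeasure \<mu> (S i))"
      using E Rb b Sb by (intro add_mono emeasure_subadditive emeasure_subadditive_countably) auto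
    also have "\<dots> \<le> (0 + ennreal c) + ennreal (2 * c)"
      using E(2) I(3) sum by (intro add_mono) auto
    also have "\<dots> = ennreal (3 * c)" using c by (simp flip: ennreal_plus)
    finally show ?thesis .
  qed
  moreover have "\<exists>B. open B \<and> h \<in> B \<and> (\<forall>h'\<in>B \<inter> C. (h' \<in> A i) = (h \<in> A i))" if h: "h \<in> C" for i h
  proof (cases "h \<in> A i")
    case True
    have "open (- J i)" by (intro open_Compl compact_imp_closed J(1))
    moreover have "h \<in> - J i" "\<forall>h'\<in>- J i \<inter> C. (h' \<in> A i) = (h \<in> A i)"
      using True J(2)[of i] K(2)[of i] by (auto simp: C_def)
    ultimately show ?thesis by blast
  next
    case False
    have "open (- K i)" by (intro open_Compl compact_imp_closed K(1))
    moreover have "h \<in> - K i" "\<forall>h'\<in>- K i \<inter> C. (h' \<in> A i) = (h \<in> A i)"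
      using False h J(2)[of i] K(2)[of i] by (auto simp: C_def)
    ultimately show ?thesis by blast
  qed
  ultimately show ?thesis by blast
qed

lemma conull_compact_clopen_pieces:
  fixes A :: "nat \<Rightarrow> 'h set"
  assumes A: "\<And>i. A i \<in> sets borel" and E: "E \<in> sets borel" "emeasure \<mu> (- E) = 0"
  obtains C :: "nat \<Rightarrow> 'h set" where "\<forall>n. compact (C n)" "\<forall>n. C n \<subseteq> E"
    "emeasure \<mu> (- (\<Union>n. C n)) = 0"
    "\<forall>n i. \<forall>h\<in>C n. \<exists>B. open B \<and> h \<in> B \<and> (\<forall>h'\<in>B \<inter> C n. (h' \<in> A i) = (h \<in> A i))"
proof -
  obtain R :: "nat \<Rightarrow> 'h set" where R: "\<forall>n. compact (R n)" "(\<Union>n. R n) = UNIV"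
    using sigma_compact[OF lc] .
  have "\<forall>j k. \<exists>C. compact C \<and> C \<subseteq> E \<and> emeasure \<mu> (R j - C) \<le> ennreal (3 * (1 / real (Suc k))) \<and>
    (\<forall>i. \<forall>h\<in>C. \<exists>B. open B \<and> h \<in> B \<and> (\<forall>h'\<in>B \<inter> C. (h' \<in> A i) = (h \<in> A i)))"
    using R(1) by (intro allI compact_clopen_pieces A E) auto
  then have "\<forall>p. \<exists>C. compact C \<and> C \<subseteq> E \<and> emeasure \<mu> (R (fst p) - C) \<le> ennreal (3 * (1 / real (Suc (snd p)))) \<and>
    (\<forall>i. \<forall>h\<in>C. \<exists>B. open B \<and> h \<in> B \<and> (\<forall>h'\<in>B \<inter> C. (h' \<in> A i) = (h \<in> A i)))"
    by blast
  from choice[OF this] obtain D where D: "\<forall>p. compact (D p) \<and> D p \<subseteq> E \<and>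
    emeasure \<mu> (R (fst p) - D p) \<le> ennreal (3 * (1 / real (Suc (snd p)))) \<and>
    (\<forall>i. \<forall>h\<in>D p. \<exists>B. open B \<and> h \<in> B \<and> (\<forall>h'\<in>B \<inter> D p. (h' \<in> A i) = (h \<in> A i)))" ..
  define C where "C j k = D (j, k)" for j k
  have C: "compact (C j k)" "C j k \<subseteq> E"
    "emeasure \<mu> (R j - C j k) \<le> ennreal (3 * (1 / real (Suc k)))"
    "\<forall>i. \<forall>h\<in>C j k. \<exists>B. open B \<and> h \<in> B \<and> (\<forall>h'\<in>B \<inter> C j k. (h' \<in> A i) = (h \<in> A i))" for j k
    unfolding C_def using D[rule_format, of "(j, k)"] by auto
  define C' where "C' n = (case prod_decode n of (j, k) \<Rightarrow> C j k)" for n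
  have C'C: "\<exists>j k. C' n = C j k" for n by (auto simp: C'_def split: prod.split)
  have CC': "C j k = C' (prod_encode (j, k))" for j k by (simp add: C'_def)
  have b: "C j k \<in> sets borel" "R j \<in> sets borel" for j k using C R by (auto intro: borel_compact)
  have "R j - (\<Union>k. C j k) \<in> null_sets \<mu>" for j
  proof -
    have bound: "emeasure \<mu> (R j - (\<Union>k. C j k)) \<le> ennreal (3 * (1 / real (Suc k)))" for k
      by (rule order_trans[OF emeasure_mono C(3)[of j k]]) (use b in auto)
    have "(\<lambda>k. ennreal (3 * (1 / real (Suc k)))) \<longlonglongrightarrow> ennreal (3 * 0)"
      by (intro tendsto_ennrealI tendsto_mult tendsto_const LIMSEQ_Suc[OF lim_1_over_n])
    then have "emeasure \<mu> (R j - (\<Union>k. C j k)) \<le> ennreal (3 * 0)"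
      by (rule tendsto_lowerbound) (use bound in auto)
    then show ?thesis using b by (auto simp: null_sets_def)
  qed
  then have null: "(\<Union>j. R j - (\<Union>k. C j k)) \<in> null_sets \<mu>" by (intro null_sets_UN) 
  show ?thesis
  proof
    have cC': "compact (C' n)" for n using C'C[of n] C(1) by auto
    then show "\<forall>n. compact (C' n)" by blast
    show "\<forall>n. C' n \<subseteq> E"
    proof
      fix n show "C' n \<subseteq> E" using C'C[of n] C(2) by auto
    qed
    have "x \<in> (\<Union>j. R j - (\<Union>k. C j k))" if x: "x \<in> - (\<Union>n. C' n)" for x
    proof -
      have "x \<in> (\<Union>n. R n)" using R(2) by simp
      then obtain j where "x \<in> R j" by blast
      moreover have "x \<notin> C j k" for k using x CC'[of j k] by auto
      ultimately show ?thesis by blast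
    qed
    then have "- (\<Union>n. C' n) \<subseteq> (\<Union>j. R j - (\<Union>k. C j k))" by blast
    moreover have "- (\<Union>n. C' n) \<in> sets \<mu>"
      unfolding sets_\<mu> by (intro borel_comp sets.countable_UN) (use cC' borel_compact in blast)
    ultimately have "- (\<Union>n. C' n) \<in> null_sets \<mu>" using null_sets_subset[OF null] by blast
    then show "emeasure \<mu> (- (\<Union>n. C' n)) = 0" by (simp add: null_sets_def)
    show "\<forall>n i. \<forall>h\<in>C' n. \<exists>B. open B \<and> h \<in> B \<and> (\<forall>h'\<in>B \<inter> C' n. (h' \<in> A i) = (h \<in> A i))"
    proof (intro allI)
      fix n i
      obtain j k where "C' n = C j k" using C'C[of n] by blast
      then show "\<forall>h\<in>C' n. \<exists>B. open B \<and> h \<in> B \<and> (\<forall>h'\<in>B \<inter> C' n. (h' \<in> A i) = (h \<in> A i))"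
        using C(4)[of j k] by metis
    qed
  qed
qed

end

section \<open>Point patterns of a cut-and-project scheme\<close>

text \<open>Throughout, \<open>'g\<close> is called the physical space and \<open>'h\<close> the internal space.\<close>

locale cut_project =
  fixes L :: "('g::{topological_ab_group_add,t2_space,second_countable_topology} \<times>
               'h::{topological_ab_group_add,t2_space,second_countable_topology}) set"
    and W :: "'h set"
  assumes scheme: "cut_and_project_scheme L"
    and window_borel: "W \<in> sets borel"
    and window_compact: "compact (closure W)"
begin

lemma lc_G: "locally_compact_space (euclidean :: 'g topology)"
  and lc_H: "locally_compact_space (euclidean :: 'h topology)"
  and inj_fst: "inj_on fst L"
  and dense_snd: "closure (snd ` L) = UNIV"
  using scheme by (auto simp: cut_and_project_scheme_def)

sublocale discrete_subgroup L
  using scheme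
  by unfold_locales (auto simp: cut_and_project_scheme_def intro: locally_compact_prod)

text \<open>The map \<^const>\<open>nu_G\<close> lifted from cosets to their representatives, where continuity and Borel sets can be
  discussed coordinatewise.\<close>

definition pattern :: "'g \<times> 'h \<Rightarrow> 'g measure" where
  "pattern z = nu_G W (z +o L)"

text \<open>This is where relative compactness of the window enters: it confines the lattice points that can
  contribute to a bounded region of the pattern to a compact subset of the product, uniformly over
  base points in a compact set.\<close>

lemma finite_returns:
  assumes "compact K" "compact J" "compact I"
  shows "finite {l \<in> L. \<exists>g\<in>J. \<exists>h\<in>I. g + fst l \<in> K \<and> h + snd l \<in> W}"
proof -
  have fin: "finite (L \<inter> ((\<lambda>(a, b). a - b) ` (K \<times> J) \<times> (\<lambda>(a, b). a - b) ` (closure W \<times> I)))"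
    by (intro locally_finite compact_Times compact_minus assms window_compact)
  have mem: "l \<in> (\<lambda>(a, b). a - b) ` (K \<times> J) \<times> (\<lambda>(a, b). a - b) ` (closure W \<times> I)"
    if "g \<in> J" "h \<in> I" "g + fst l \<in> K" "h + snd l \<in> W" for l g h
  proof -
    have "(g + fst l, g) \<in> K \<times> J" "(h + snd l, h) \<in> closure W \<times> I"
      using that closure_subset by auto
    then have "fst l \<in> (\<lambda>(a, b). a - b) ` (K \<times> J)" "snd l \<in> (\<lambda>(a, b). a - b) ` (closure W \<times> I)"
      by (force intro: rev_image_eqI)+
    then show ?thesis by (simp add: mem_Times_iff)
  qed
  show ?thesis by (rule finite_subset[OF _ fin]) (use mem in blast)
qed

text \<open>In this form the pattern is indexed by lattice points, so that moving the base point changes only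
  the index set and the map.\<close>

lemma pattern_eq:
  "pattern z = distr (count_space {l \<in> L. snd z + snd l \<in> W}) borel (\<lambda>l. fst z + fst l)"
  (is "_ = distr (count_space ?I) borel ?p")
proof (rule measure_eqI)
  show "sets (pattern z) = sets (distr (count_space ?I) borel ?p)"
    by (simp add: pattern_def nu_G_def)
  fix A assume "A \<in> sets (pattern z)"
  then have A: "A \<in> sets borel" by (simp add: pattern_def nu_G_def)
  let ?S = "(z +o L) \<inter> (UNIV \<times> W)"
  have sets_pm: "sets (point_masses S) = sets borel" for S :: "('g \<times> 'h) set"
    unfolding point_masses_def
    by (metis sets.sigma_sets_eq sets.space_closed sets_measure_of space_borel)
  have fst_m: "fst \<in> (borel :: ('g \<times> 'h) measure) \<rightarrow>\<^sub>M borel"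
    by (intro borel_measurable_continuous_onI continuous_intros)
  have fA: "fst -` A \<in> sets (borel :: ('g \<times> 'h) measure)"
    using measurable_sets[OF fst_m A] by simp
  have "emeasure (pattern z) A = emeasure (point_masses ?S) (fst -` A)"
    unfolding pattern_def nu_G_def nu_def
    using A fst_m sets_eq_imp_space_eq[OF sets_pm]
    by (subst emeasure_distr) (simp_all cong: measurable_cong_sets add: sets_pm)
  also have "\<dots> = emeasure (count_space ?S) (?S \<inter> fst -` A)"
    unfolding emeasure_point_masses[OF fA] by (rule infsum_return[OF fA])
  finally have 1: "emeasure (pattern z) A = emeasure (count_space ?S) (?S \<inter> fst -` A)" .
  have 2: "emeasure (distr (count_space ?I) borel ?p) A = emeasure (count_space ?I) {l \<in> ?I. ?p l \<in> A}"
    using A by (subst emeasure_distr) (auto intro!: arg_cong2[where f = emeasure])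
  have bij: "bij_betw ((+) z) {l \<in> ?I. ?p l \<in> A} (?S \<inter> fst -` A)"
  proof (rule bij_betw_imageI)
    show "(+) z ` {l \<in> ?I. ?p l \<in> A} = ?S \<inter> fst -` A"
    proof (intro equalityI subsetI)
      fix y assume "y \<in> ?S \<inter> fst -` A"
      then have "y - z \<in> L" "snd y \<in> W" "fst y \<in> A" "y = z + (y - z)"
        by (auto simp: mem_coset)
      then show "y \<in> (+) z ` {l \<in> ?I. ?p l \<in> A}"
        by (intro image_eqI[of _ _ "y - z"]) auto
    next
      fix y assume "y \<in> (+) z ` {l \<in> ?I. ?p l \<in> A}"
      then obtain l where l: "y = z + l" "l \<in> L" "snd z + snd l \<in> W" "fst z + fst l \<in> A" by blast
      from l(2-4) show "y \<in> ?S \<inter> fst -` A" by (simp add: l(1) mem_coset mem_Times_iff)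
    qed
  qed (simp add: inj_on_def)
  have "emeasure (count_space ?S) (?S \<inter> fst -` A) =
      (if finite (?S \<inter> fst -` A) then of_nat (card (?S \<inter> fst -` A)) else \<infinity>)"
    by (rule emeasure_count_space) blast
  moreover have "emeasure (count_space ?I) {l \<in> ?I. ?p l \<in> A} =
      (if finite {l \<in> ?I. ?p l \<in> A} then of_nat (card {l \<in> ?I. ?p l \<in> A}) else \<infinity>)"
    by (rule emeasure_count_space) blast
  ultimately show "emeasure (pattern z) A = emeasure (distr (count_space ?I) borel ?p) A"
    unfolding 1 2 by (simp only: bij_betw_finite[OF bij] bij_betw_same_card[OF bij])
qed

lemma regular_pattern: "regular_borel_measure euclidean (pattern z)"
  unfolding pattern_eq
proof (rule regular_counting_measure[OF lc_G])
  fix K :: "'g set" assume "compact K"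
  then have "finite {l \<in> L. \<exists>g\<in>{fst z}. \<exists>h\<in>{snd z}. g + fst l \<in> K \<and> h + snd l \<in> W}"
    by (intro finite_returns) auto
  then show "finite {i \<in> {l \<in> L. snd z + snd l \<in> W}. fst z + fst i \<in> K}"
    by (rule rev_finite_subset) auto
qed

lemma emeasure_pattern_nonzero:
  "emeasure (pattern z) {p} \<noteq> 0 \<longleftrightarrow> (\<exists>l\<in>L. snd z + snd l \<in> W \<and> fst z + fst l = p)"
proof -
  have "emeasure (pattern z) {p} =
      emeasure (count_space {l \<in> L. snd z + snd l \<in> W}) {l \<in> L. snd z + snd l \<in> W \<and> fst z + fst l = p}"
    unfolding pattern_eq by (subst emeasure_distr) (auto intro!: arg_cong2[where f = emeasure])
  also have "\<dots> \<noteq> 0 \<longleftrightarrow> (\<exists>l\<in>L. snd z + snd l \<in> W \<and> fst z + fst l = p)"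
    unfolding emeasure_count_space_eq_0 by blast
  finally show ?thesis .
qed

lemma integral_pattern:
  fixes f :: "'g \<Rightarrow> real"
  assumes f: "continuous_on UNIV f"
    and F: "finite F" "F \<subseteq> L" "\<And>l. l \<in> L \<Longrightarrow> snd z + snd l \<in> W \<Longrightarrow> f (fst z + fst l) \<noteq> 0 \<Longrightarrow> l \<in> F"
  shows "(\<integral>x. f x \<partial>pattern z) = (\<Sum>l\<in>F. if snd z + snd l \<in> W then f (fst z + fst l) else 0)"
proof -
  let ?I = "{l \<in> L. snd z + snd l \<in> W}"
  let ?J = "{l. l \<in> ?I \<and> f (fst z + fst l) \<noteq> 0}"
  have JF: "?J \<subseteq> F" using F(3) by auto
  have "(\<integral>x. f x \<partial>pattern z) = (\<integral>l. f (fst z + fst l) \<partial>count_space ?I)"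
    unfolding pattern_eq by (intro integral_distr borel_measurable_continuous_onI f) simp
  also have "\<dots> = (\<Sum>l\<in>?J. f (fst z + fst l))"
    using finite_subset[OF JF F(1)] by (intro lebesgue_integral_count_space_finite_support) simp
  also have "\<dots> = (\<Sum>l\<in>?J. if snd z + snd l \<in> W then f (fst z + fst l) else 0)"
    by (intro sum.cong) auto
  also have "\<dots> = (\<Sum>l\<in>F. if snd z + snd l \<in> W then f (fst z + fst l) else 0)"
    using F JF by (intro sum.mono_neutral_left) auto
  finally show ?thesis .
qed

text \<open>The only discontinuity of the pattern comes from points of the coset that enter or leave the strip
  over the window. Near a base point only finitely many lattice points \<open>l\<close> matter for a given vague
  neighbourhood; once it is fixed which of the points \<open>h + snd l\<close> lie in the window, integrals of test
  functions are finite sums of continuous functions of the physical coordinate.\<close>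

lemma pattern_locally_continuous:
  assumes "openin vague_topology Q" "pattern (g, h) \<in> Q"
  shows "\<exists>A B F. open A \<and> g \<in> A \<and> open B \<and> h \<in> B \<and> finite F \<and> F \<subseteq> L \<and>
    (\<forall>g'\<in>A. \<forall>h'\<in>B. (\<forall>l\<in>F. (h' + snd l \<in> W) = (h + snd l \<in> W)) \<longrightarrow> pattern (g', h') \<in> Q)"
proof -
  have "generate_topology_on {{m. regular_borel_measure euclidean m \<and> (\<integral>x. f x \<partial>m) \<in> U} | (f :: 'g \<Rightarrow> real) U.
        continuous_on UNIV f \<and> compact (closure {x. f x \<noteq> 0}) \<and> open U} Q"
    using assms(1) unfolding vague_topology_def by (rule openin_topology_generated_by)
  from this assms(2) show ?thesis
  proof (induction rule: generate_topology_on.induct)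
    case Empty
    then show ?case by simp
  next
    case (Int Q1 Q2)
    obtain A1 B1 F1 where 1: "open A1" "g \<in> A1" "open B1" "h \<in> B1" "finite F1" "F1 \<subseteq> L"
      "\<forall>g'\<in>A1. \<forall>h'\<in>B1. (\<forall>l\<in>F1. (h' + snd l \<in> W) = (h + snd l \<in> W)) \<longrightarrow> pattern (g', h') \<in> Q1"
      using Int.IH(1) Int.prems by (elim IntE) (drule (1) meta_mp, elim exE conjE, rule that)
    obtain A2 B2 F2 where 2: "open A2" "g \<in> A2" "open B2" "h \<in> B2" "finite F2" "F2 \<subseteq> L"
      "\<forall>g'\<in>A2. \<forall>h'\<in>B2. (\<forall>l\<in>F2. (h' + snd l \<in> W) = (h + snd l \<in> W)) \<longrightarrow> pattern (g', h') \<in> Q2"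
      using Int.IH(2) Int.prems by (elim IntE) (drule (1) meta_mp, elim exE conjE, rule that)
    show ?case
      using 1 2
      by (intro exI[of _ "A1 \<inter> A2"] exI[of _ "B1 \<inter> B2"] exI[of _ "F1 \<union> F2"]) auto
  next
    case (UN \<Q>)
    then obtain Q' where Q': "Q' \<in> \<Q>" "pattern (g, h) \<in> Q'" by blast
    from UN.IH[OF Q'] obtain A B F where "open A" "g \<in> A" "open B" "h \<in> B" "finite F" "F \<subseteq> L"
      "\<forall>g'\<in>A. \<forall>h'\<in>B. (\<forall>l\<in>F. (h' + snd l \<in> W) = (h + snd l \<in> W)) \<longrightarrow> pattern (g', h') \<in> Q'"
      by (elim exE conjE) (rule that)
    then show ?case
      using Q'(1) by (intro exI[of _ A] exI[of _ B] exI[of _ F]) auto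
  next
    case (Basis Q)
    then obtain f :: "'g \<Rightarrow> real" and U where f: "continuous_on UNIV f"
        "compact (closure {x. f x \<noteq> 0})" "open U"
      and Q: "Q = {m. regular_borel_measure euclidean m \<and> (\<integral>x. f x \<partial>m) \<in> U}"
      by blast
    obtain A K where A: "open A" "g \<in> A" "A \<subseteq> K" "compact K"
      using locally_compact_nhd[OF lc_G] .
    obtain B J where B: "open B" "h \<in> B" "B \<subseteq> J" "compact J"
      using locally_compact_nhd[OF lc_H] .
    define F where "F = {l \<in> L. \<exists>g\<in>K. \<exists>h\<in>J. g + fst l \<in> closure {x. f x \<noteq> 0} \<and> h + snd l \<in> W}"
    have F: "finite F" "F \<subseteq> L"
      using finite_returns[OF f(2) A(4) B(4)] by (auto simp: F_def)
    have int: "(\<integral>x. f x \<partial>pattern (g', h')) = (\<Sum>l\<in>F. if h' + snd l \<in> W then f (g' + fst l) else 0)"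
      if "g' \<in> A" "h' \<in> B" for g' h'
    proof -
      have "l \<in> F" if l: "l \<in> L" "h' + snd l \<in> W" "f (g' + fst l) \<noteq> 0" for l
      proof -
        have "g' + fst l \<in> closure {x. f x \<noteq> 0}" using l(3) closure_subset by fastforce
        then show ?thesis
          using l \<open>g' \<in> A\<close> \<open>h' \<in> B\<close> A(3) B(3) unfolding F_def by blast
      qed
      then show ?thesis
        by (rule integral_pattern[OF f(1) F, of "(g', h')", unfolded fst_conv snd_conv])
    qed
    define \<phi> where "\<phi> g' = (\<Sum>l\<in>F. if h + snd l \<in> W then f (g' + fst l) else 0)" for g'
    have "continuous_on UNIV \<phi>"
      unfolding \<phi>_def
    proof (intro continuous_on_sum)
      fix l assume "l \<in> F"
      show "continuous_on UNIV (\<lambda>g'. if h + snd l \<in> W then f (g' + fst l) else 0)"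
        by (cases "h + snd l \<in> W")
          (auto intro!: continuous_on_compose2[OF f(1)] continuous_intros)
    qed
    then have "open (A \<inter> \<phi> -` U)" by (intro open_Int A open_vimage f)
    moreover have "g \<in> A \<inter> \<phi> -` U"
      using Basis.prems int[OF A(2) B(2)] A(2) by (simp add: Q \<phi>_def)
    moreover have "pattern (g', h') \<in> Q"
      if "g' \<in> A \<inter> \<phi> -` U" "h' \<in> B" "\<forall>l\<in>F. (h' + snd l \<in> W) = (h + snd l \<in> W)" for g' h'
    proof -
      have "(\<integral>x. f x \<partial>pattern (g', h')) = \<phi> g'"
        unfolding \<phi>_def using that by (subst int) (auto intro!: sum.cong)
      then show ?thesis using that by (simp add: Q regular_pattern)
    qed
    ultimately show ?case using B(1,2) F
      by (intro exI[of _ "A \<inter> \<phi> -` U"] exI[of _ B] exI[of _ F] conjI) blast+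
  qed
qed

text \<open>The sets on which finitely many window conditions are fixed are Borel, and there are only countably
  many of them with basic open coordinates. By local continuity every preimage of a vaguely open set is
  a union of such sets. In other words, the pattern is continuous once the internal space carries the
  finer, still second countable topology in which all \<open>W - snd l\<close> are clopen.\<close>

lemma borel_pattern_vimage:
  assumes Q: "openin vague_topology Q"
  shows "pattern -` Q \<in> sets borel"
proof -
  obtain \<A> :: "'g set set" where \<A>: "countable \<A>" "topological_basis \<A>"
    using ex_countable_basis by blast
  obtain \<B> :: "'h set set" where \<B>: "countable \<B>" "topological_basis \<B>"
    using ex_countable_basis by blast
  let ?\<F> = "{F. finite F \<and> F \<subseteq> L}"
  have \<F>: "countable ?\<F>" using countable_Collect_finite_subset[OF countable] .
  define Z where "Z = (\<lambda>(A :: 'g set, B, F :: ('g \<times> 'h) set, S). A \<times> (B \<inter> (\<Inter>l\<in>F. {h. (h + snd l \<in> W) = (l \<in> S)})))"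
  have Zb: "Z (A, B, F, S) \<in> sets borel" if "A \<in> \<A>" "B \<in> \<B>" "F \<in> ?\<F>" for A B F S
  proof -
    have "{h. (h + snd l \<in> W) = (l \<in> S)} \<in> sets borel" for l
    proof -
      have "(\<lambda>h::'h. h + snd l) \<in> borel \<rightarrow>\<^sub>M borel"
        by (intro borel_measurable_continuous_onI continuous_intros)
      from measurable_sets[OF this window_borel] have "(\<lambda>h. h + snd l) -` W \<in> sets borel" by simp
      moreover have "{h. (h + snd l \<in> W) = (l \<in> S)} =
          (if l \<in> S then (\<lambda>h. h + snd l) -` W else - ((\<lambda>h. h + snd l) -` W))"
        by auto
      ultimately show ?thesis by (auto intro: borel_comp)
    qed
    moreover have "open A" "open B"
      using that \<A> \<B> by (auto intro: topological_basis_open)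
    ultimately have "A \<times> (B \<inter> (\<Inter>l\<in>F. {h. (h + snd l \<in> W) = (l \<in> S)})) \<in> sets (borel \<Otimes>\<^sub>M borel)"
      using that(3) by (cases "F = {}") (auto intro!: pair_measureI sets.Int sets.finite_INT)
    then show ?thesis unfolding borel_prod Z_def by simp
  qed
  have "pattern -` Q = \<Union>{Y \<in> Z ` (\<A> \<times> \<B> \<times> ?\<F> \<times> ?\<F>). Y \<subseteq> pattern -` Q}"
  proof (intro equalityI subsetI)
    fix z assume "z \<in> pattern -` Q"
    then have "pattern (fst z, snd z) \<in> Q" by simp
    from pattern_locally_continuous[OF Q this]
    obtain A B F where ABF: "open A" "fst z \<in> A" "open B" "snd z \<in> B" "finite F" "F \<subseteq> L"
      "\<forall>g'\<in>A. \<forall>h'\<in>B. (\<forall>l\<in>F. (h' + snd l \<in> W) = (snd z + snd l \<in> W)) \<longrightarrow> pattern (g', h') \<in> Q"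
      by (elim exE conjE) (rule that)
    obtain A' where A': "A' \<in> \<A>" "fst z \<in> A'" "A' \<subseteq> A"
      using topological_basisE[OF \<A>(2) ABF(1,2)] .
    obtain B' where B': "B' \<in> \<B>" "snd z \<in> B'" "B' \<subseteq> B"
      using topological_basisE[OF \<B>(2) ABF(3,4)] .
    \<comment> \<open>\<open>S\<close> records which of the window conditions in \<open>F\<close> hold at \<open>z\<close>.\<close>
    define S where "S = {l \<in> F. snd z + snd l \<in> W}"
    have "Z (A', B', F, S) \<subseteq> pattern -` Q"
    proof
      fix y assume "y \<in> Z (A', B', F, S)"
      then have y: "y \<in> A' \<times> (B' \<inter> (\<Inter>l\<in>F. {h. (h + snd l \<in> W) = (l \<in> S)}))"
        unfolding Z_def by simp
      then have "fst y \<in> A'" "snd y \<in> B'" by auto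
      moreover have "\<forall>l\<in>F. (snd y + snd l \<in> W) = (snd z + snd l \<in> W)"
      proof
        fix l assume "l \<in> F"
        then have "(snd y + snd l \<in> W) = (l \<in> S)" using y by (simp add: mem_Times_iff)
        then show "(snd y + snd l \<in> W) = (snd z + snd l \<in> W)" using \<open>l \<in> F\<close> by (simp add: S_def)
      qed
      moreover have "fst y \<in> A" "snd y \<in> B" using calculation(1,2) A'(3) B'(3) by auto
      ultimately have "pattern (fst y, snd y) \<in> Q" using ABF(7) by blast
      then show "y \<in> pattern -` Q" by simp
    qed
    moreover have "z \<in> Z (A', B', F, S)"
      using A'(2) B'(2) unfolding Z_def S_def by (simp add: mem_Times_iff)
    moreover have "(A', B', F, S) \<in> \<A> \<times> \<B> \<times> ?\<F> \<times> ?\<F>"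
      using A'(1) B'(1) ABF(5,6) unfolding S_def by auto
    ultimately show "z \<in> \<Union>{Y \<in> Z ` (\<A> \<times> \<B> \<times> ?\<F> \<times> ?\<F>). Y \<subseteq> pattern -` Q}" by blast
  qed blast
  also have "\<dots> \<in> sets borel"
  proof (rule sets.countable_Union)
    have "countable (Z ` (\<A> \<times> \<B> \<times> ?\<F> \<times> ?\<F>))"
      by (intro countable_image countable_SIGMA \<A>(1) \<B>(1) \<F>)
    then show "countable {Y \<in> Z ` (\<A> \<times> \<B> \<times> ?\<F> \<times> ?\<F>). Y \<subseteq> pattern -` Q}"
      by (rule countable_subset[rotated]) blast
    show "{Y \<in> Z ` (\<A> \<times> \<B> \<times> ?\<F> \<times> ?\<F>). Y \<subseteq> pattern -` Q} \<subseteq> sets borel"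
    proof
      fix Y assume "Y \<in> {Y \<in> Z ` (\<A> \<times> \<B> \<times> ?\<F> \<times> ?\<F>). Y \<subseteq> pattern -` Q}"
      then obtain A B F S where "A \<in> \<A>" "B \<in> \<B>" "F \<in> ?\<F>" "Y = Z (A, B, F, S)" by blast
      then show "Y \<in> sets borel" using Zb by simp
    qed
  qed
  finally show ?thesis .
qed

abbreviation hull_borel :: "'g measure measure" where
  "hull_borel \<equiv> borel_of (subtopology vague_topology (extended_hull L W))"

lemma pattern_in_hull: "pattern z \<in> extended_hull L W"
proof -
  have "nu_G W ` torus L \<subseteq> topspace vague_topology"
    using regular_pattern by (auto simp: topspace_vague_topology torus_def pattern_def)
  from closure_of_subset[OF this] show ?thesis
    by (auto simp: extended_hull_def pattern_def)
qed

lemma space_hull_borel: "space hull_borel = extended_hull L W"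
  by (simp add: extended_hull_def closure_of_subset_topspace inf.absorb2)

lemma pattern_measurable: "pattern \<in> borel \<rightarrow>\<^sub>M hull_borel"
proof (rule measurable_into_borel_of)
  show "pattern \<in> space borel \<rightarrow> topspace (subtopology vague_topology (extended_hull L W))"
    using pattern_in_hull space_hull_borel by simp
  fix U assume "openin (subtopology vague_topology (extended_hull L W)) U"
  then obtain Q where Q: "openin vague_topology Q" "U = Q \<inter> extended_hull L W"
    by (auto simp: openin_subtopology)
  then have "pattern -` U \<inter> space borel = pattern -` Q"
    using pattern_in_hull by auto
  then show "pattern -` U \<inter> space borel \<in> sets borel"
    using borel_pattern_vimage[OF Q(1)] by simp
qed

lemma nu_G_measurable: "nu_G W \<in> borel_of (torus_topology L) \<rightarrow>\<^sub>M hull_borel"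
proof -
  obtain s where s: "s \<in> borel_of (torus_topology L) \<rightarrow>\<^sub>M borel" "\<forall>c\<in>torus L. s c +o L = c"
    by (rule measurable_section)
  have "(\<lambda>c. pattern (s c)) \<in> borel_of (torus_topology L) \<rightarrow>\<^sub>M hull_borel"
    using measurable_compose[OF s(1) pattern_measurable] .
  then show ?thesis
    by (rule measurable_cong[THEN iffD1, rotated])
      (use s(2) in \<open>auto simp: pattern_def topspace_torus_topology\<close>)
qed

section \<open>Generic points are recovered from their patterns\<close>

text \<open>Seen from the point of the pattern that belongs to \<open>l\<close>, a point at displacement \<open>fst m\<close> can
  only belong to \<open>l + m\<close>, because the projection to the physical space is injective on the lattice.
  So the pattern answers the question whether \<open>snd (z + l) + snd m\<close> lies in the window.\<close>

lemma support_shift: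
  assumes l: "l \<in> L" and m: "m \<in> L"
  shows "(\<exists>k\<in>L. snd z + snd k \<in> W \<and> fst z + fst k = fst (z + l) + fst m) \<longleftrightarrow>
    snd (z + l) + snd m \<in> W"
proof
  assume "\<exists>k\<in>L. snd z + snd k \<in> W \<and> fst z + fst k = fst (z + l) + fst m"
  then obtain k where k: "k \<in> L" "snd z + snd k \<in> W" "fst z + fst k = fst (z + l) + fst m" by blast
  then have "fst k = fst (l + m)" by (simp add: add.assoc)
  then have "k = l + m" using inj_fst k(1) add_in[OF l m] by (meson inj_onD)
  then show "snd (z + l) + snd m \<in> W" using k(2) by (simp add: add.assoc)
next
  assume "snd (z + l) + snd m \<in> W"
  then show "\<exists>k\<in>L. snd z + snd k \<in> W \<and> fst z + fst k = fst (z + l) + fst m"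
    using add_in[OF l m] by (intro bexI[of _ "l + m"]) (auto simp: add.assoc)
qed

text \<open>A common point of the two patterns lets both cosets be represented with the same physical
  coordinate, and then the two internal coordinates visit the window along the same elements of
  \<open>snd ` L\<close>; genericity identifies them. Two empty patterns have no common point. But then \<open>h\<close> and
  \<open>h + d\<close>, for each \<open>d\<close> in \<open>snd ` L\<close>, are generic points that never visit the window, so they
  coincide; this makes the internal space trivial, and a nonempty window is then everything.\<close>

lemma pattern_injective:
  assumes E: "\<forall>h\<in>E. \<forall>d\<in>snd ` L. h + d \<in> E"
    "\<forall>h\<in>E. \<forall>h'\<in>E. (\<forall>d\<in>snd ` L. (h + d \<in> W) = (h' + d \<in> W)) \<longrightarrow> h = h'"
    and "W \<noteq> {}"
    and z: "snd z \<in> E" "snd z' \<in> E" and eq: "pattern z = pattern z'"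
  shows "z +o L = z' +o L"
proof -
  have supp: "(\<exists>l\<in>L. snd z + snd l \<in> W \<and> fst z + fst l = p) \<longleftrightarrow>
      (\<exists>l\<in>L. snd z' + snd l \<in> W \<and> fst z' + fst l = p)" for p
    unfolding emeasure_pattern_nonzero[symmetric] eq ..
  have "\<exists>l\<in>L. snd z + snd l \<in> W"
  proof (rule ccontr)
    assume no: "\<not> (\<exists>l\<in>L. snd z + snd l \<in> W)"
    have "snd l = 0" if l: "l \<in> L" for l
    proof -
      have "snd z + snd l + snd k \<notin> W" if "k \<in> L" for k
        using no add_in[OF l that] by (metis add.assoc snd_add)
      then have "snd z + snd l = snd z"
        using E z(1) l no by (intro E(2)[rule_format]) auto
      then show ?thesis by simp
    qed
    then have "snd ` L = {0}" using zero_in by force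
    then have "(UNIV :: 'h set) = {0}" using dense_snd by simp
    then have "h = 0" for h :: 'h by blast
    then have "snd z + snd (0 :: 'g \<times> 'h) \<in> W" using \<open>W \<noteq> {}\<close> by (metis ex_in_conv)
    then show False using no zero_in by blast
  qed
  then obtain l where l: "l \<in> L" "snd z + snd l \<in> W" by blast
  then obtain l' where l': "l' \<in> L" "snd z' + snd l' \<in> W" "fst z' + fst l' = fst z + fst l"
    using supp[of "fst z + fst l"] by blast
  define y where "y = z + l"
  define y' where "y' = z' + l'"
  have fst_eq: "fst y = fst y'" using l' by (simp add: y_def y'_def)
  have y: "(\<exists>k\<in>L. snd z + snd k \<in> W \<and> fst z + fst k = fst y + fst m) \<longleftrightarrow> snd y + snd m \<in> W"
    if "m \<in> L" for m
    unfolding y_def by (rule support_shift[OF l(1) that])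
  have y': "(\<exists>k\<in>L. snd z' + snd k \<in> W \<and> fst z' + fst k = fst y' + fst m) \<longleftrightarrow> snd y' + snd m \<in> W"
    if "m \<in> L" for m
    unfolding y'_def by (rule support_shift[OF l'(1) that])
  have "\<forall>d\<in>snd ` L. (snd y + d \<in> W) = (snd y' + d \<in> W)"
    using y y' supp fst_eq by auto
  moreover have "snd y \<in> E" "snd y' \<in> E" using E(1) z l l' by (auto simp: y_def y'_def)
  ultimately have "snd y = snd y'" using E(2) by blast
  with fst_eq have "y = y'" by (simp add: prod_eq_iff)
  have "z +o L = y +o L" unfolding coset_eq_iff using l by (simp add: y_def)
  also have "\<dots> = z' +o L" unfolding coset_eq_iff \<open>y = y'\<close> using minus_in[OF l'(1)] by (simp add: y'_def)
  finally show ?thesis .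
qed

section \<open>Continuity of patterns where the window is clopen\<close>

text \<open>On a set where all translates of the window are relatively clopen, the window conditions are locally
  constant, so local continuity becomes continuity.\<close>

lemma continuous_pattern:
  assumes C: "\<forall>l\<in>L. \<forall>h\<in>C. \<exists>B. open B \<and> h \<in> B \<and> (\<forall>h'\<in>B \<inter> C. (h' + snd l \<in> W) = (h + snd l \<in> W))"
  shows "continuous_map (top_of_set (UNIV \<times> C)) vague_topology pattern"
  unfolding continuous_map_def
proof (intro conjI allI impI)
  show "pattern \<in> topspace (top_of_set (UNIV \<times> C)) \<rightarrow> topspace vague_topology"
    using regular_pattern by (auto simp: topspace_vague_topology)
  fix Q assume Q: "openin (vague_topology :: 'g measure topology) Q"
  show "openin (top_of_set (UNIV \<times> C)) {x \<in> topspace (top_of_set (UNIV \<times> C)). pattern x \<in> Q}"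
  proof (subst openin_subopen, intro ballI)
    fix z assume "z \<in> {x \<in> topspace (top_of_set (UNIV \<times> C)). pattern x \<in> Q}"
    then have z: "snd z \<in> C" "pattern (fst z, snd z) \<in> Q" by auto
    from pattern_locally_continuous[OF Q z(2)]
    obtain A B F where ABF: "open A" "fst z \<in> A" "open B" "snd z \<in> B" "finite F" "F \<subseteq> L"
      "\<forall>g'\<in>A. \<forall>h'\<in>B. (\<forall>l\<in>F. (h' + snd l \<in> W) = (snd z + snd l \<in> W)) \<longrightarrow> pattern (g', h') \<in> Q"
      by (elim exE conjE) (rule that)
    have "\<forall>l\<in>F. \<exists>B. open B \<and> snd z \<in> B \<and> (\<forall>h'\<in>B \<inter> C. (h' + snd l \<in> W) = (snd z + snd l \<in> W))"
      using C z(1) ABF(6) by blast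
    from bchoice[OF this] obtain D where D: "\<forall>l\<in>F. open (D l) \<and> snd z \<in> D l \<and>
        (\<forall>h'\<in>D l \<inter> C. (h' + snd l \<in> W) = (snd z + snd l \<in> W))" ..
    define V where "V = A \<times> (B \<inter> (\<Inter>l\<in>F. D l))"
    have "open V"
      unfolding V_def using ABF(1,3,5) D by (intro open_Times open_Int open_INT) auto
    then have "openin (top_of_set (UNIV \<times> C)) ((UNIV \<times> C) \<inter> V)" by (rule openin_open_Int)
    moreover have "z \<in> (UNIV \<times> C) \<inter> V"
    proof -
      have "\<forall>l\<in>F. snd z \<in> D l" using D by blast
      then show ?thesis using z(1) ABF(2,4) by (simp add: V_def mem_Times_iff)
    qed
    moreover have "(UNIV \<times> C) \<inter> V \<subseteq> {x \<in> topspace (top_of_set (UNIV \<times> C)). pattern x \<in> Q}"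
    proof
      fix y assume y: "y \<in> (UNIV \<times> C) \<inter> V"
      then have "fst y \<in> A" "snd y \<in> B" "snd y \<in> C" "\<forall>l\<in>F. snd y \<in> D l"
        by (auto simp: V_def)
      moreover from this have "\<forall>l\<in>F. (snd y + snd l \<in> W) = (snd z + snd l \<in> W)"
        using D by blast
      ultimately have "pattern (fst y, snd y) \<in> Q" using ABF(7) by blast
      then show "y \<in> {x \<in> topspace (top_of_set (UNIV \<times> C)). pattern x \<in> Q}" using y by auto
    qed
    ultimately show "\<exists>T. openin (top_of_set (UNIV \<times> C)) T \<and> z \<in> T \<and>
        T \<subseteq> {x \<in> topspace (top_of_set (UNIV \<times> C)). pattern x \<in> Q}" by blast
  qed
qed

lemma pattern_image_compact:
  assumes C: "\<forall>l\<in>L. \<forall>h\<in>C. \<exists>B. open B \<and> h \<in> B \<and> (\<forall>h'\<in>B \<inter> C. (h' + snd l \<in> W) = (h + snd l \<in> W))"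
    and K: "compact K" "K \<subseteq> UNIV \<times> C"
  shows "pattern ` K \<in> sets hull_borel"
proof (rule closedin_in_borel_of)
  have "compactin (top_of_set (UNIV \<times> C)) K"
    using K by (simp add: compactin_subtopology)
  then have "compactin vague_topology (pattern ` K)"
    by (rule image_compactin[OF _ continuous_pattern[OF C]])
  then have "closedin vague_topology (pattern ` K)"
    by (rule compactin_imp_closedin[OF Hausdorff_vague_topology[OF lc_G]])
  moreover have "pattern ` K = pattern ` K \<inter> extended_hull L W" using pattern_in_hull by blast
  ultimately show "closedin (subtopology vague_topology (extended_hull L W)) (pattern ` K)"
    unfolding closedin_subtopology by blast
qed

section \<open>The two group actions\<close>

lemma torus_shift_coset: "torus_shift g (z +o L) = ((g, 0) + z) +o L"
  unfolding torus_shift_def by (rule elt_plus_coset)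

lemma nu_G_torus_shift:
  assumes "c \<in> torus L"
  shows "nu_G W (torus_shift g c) = measure_shift g (nu_G W c)"
proof -
  obtain z where z: "c = z +o L" using assms by (auto simp: torus_def)
  have "measure_shift g (pattern z) =
      distr (count_space {l \<in> L. snd z + snd l \<in> W}) borel ((+) g \<circ> (\<lambda>l. fst z + fst l))"
    unfolding measure_shift_def pattern_eq
    by (rule distr_distr) (auto simp: translation_measurable)
  also have "\<dots> = pattern ((g, 0) + z)"
    unfolding pattern_eq by (simp add: o_def add.assoc)
  finally show ?thesis by (simp add: z torus_shift_coset pattern_def)
qed

lemma continuous_torus_translation:
  "continuous_map (torus_topology L) (torus_topology L) ((+o) z)"
  unfolding continuous_map_def
proof (intro conjI allI impI)
  show "(+o) z \<in> topspace (torus_topology L) \<rightarrow> topspace (torus_topology L)"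
    by (auto simp: topspace_torus_topology torus_def elt_plus_coset)
  fix U assume U: "openin (torus_topology L) U"
  have "{x. x +o L \<in> {c \<in> torus L. z +o c \<in> U}} = (+) z -` {x. x +o L \<in> U}"
    by (auto simp: elt_plus_coset)
  moreover have "open ((+) z -` {x. x +o L \<in> U})"
    using U by (intro open_vimage continuous_intros) (simp add: openin_torus)
  ultimately show "openin (torus_topology L) {x \<in> topspace (torus_topology L). z +o x \<in> U}"
    by (simp add: openin_torus topspace_torus_topology)
qed

lemma hull_shift_invariant:
  "measure_shift g ` extended_hull L W \<subseteq> extended_hull L W"
proof -
  have "measure_shift g ` (nu_G W ` torus L) \<subseteq> nu_G W ` torus L"
  proof clarify
    fix c assume "c \<in> torus L"
    moreover from this have "torus_shift g c \<in> torus L"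
      by (auto simp: torus_def torus_shift_coset)
    ultimately show "measure_shift g (nu_G W c) \<in> nu_G W ` torus L"
      using nu_G_torus_shift[of c g] by (metis imageI)
  qed
  then have "vague_topology closure_of (measure_shift g ` (nu_G W ` torus L)) \<subseteq> extended_hull L W"
    unfolding extended_hull_def by (rule closure_of_mono)
  moreover have "measure_shift g ` extended_hull L W \<subseteq>
      vague_topology closure_of (measure_shift g ` (nu_G W ` torus L))"
    unfolding extended_hull_def
    by (rule continuous_map_image_closure_subset[OF continuous_measure_shift])
  ultimately show ?thesis by blast
qed

lemma measure_shift_measurable: "measure_shift g \<in> hull_borel \<rightarrow>\<^sub>M hull_borel"
proof (rule continuous_map_measurable)
  show "continuous_map (subtopology vague_topology (extended_hull L W))
      (subtopology vague_topology (extended_hull L W)) (measure_shift g)"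
    using hull_shift_invariant[of g]
    by (auto simp: continuous_map_in_subtopology
        intro!: continuous_map_from_subtopology continuous_measure_shift)
qed

end

section \<open>Factor maps that are injective on a conull set\<close>

text \<open>Such a factor map restricts to a bijection from \<open>B\<close> onto its image, the assumption on images says that
  its inverse is measurable, and equivariance carries invariance of \<open>B\<close> over to the image. The
  isomorphism is the inverse of this restriction.\<close>

lemma isomorphic_systems_of_injective_factor:
  fixes S :: "'g::group_add \<Rightarrow> 'y \<Rightarrow> 'y" and T :: "'g \<Rightarrow> 'x \<Rightarrow> 'x"
  assumes sys: "prob_preserving_system N T"
    and f: "f \<in> N \<rightarrow>\<^sub>M K"
    and S: "\<And>g. S g \<in> K \<rightarrow>\<^sub>M K" "\<And>y. y \<in> space K \<Longrightarrow> S 0 y = y"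
      "\<And>g h y. y \<in> space K \<Longrightarrow> S (g + h) y = S g (S h y)"
    and equivariant: "\<And>g x. x \<in> space N \<Longrightarrow> f (T g x) = S g (f x)"
    and B: "B \<in> sets N" "AE x in N. x \<in> B" "\<And>g x. x \<in> B \<Longrightarrow> T g x \<in> B"
    and inj: "inj_on f B"
    and image: "\<And>F. F \<in> sets N \<Longrightarrow> f ` (F \<inter> B) \<in> sets K"
  shows "isomorphic_systems (distr N K f) S N T"
proof -
  let ?M = "distr N K f"
  interpret N: prob_space N using sys by (simp add: prob_preserving_system_def)
  have T: "T g \<in> N \<rightarrow>\<^sub>M N" "distr N N (T g) = N" "x \<in> space N \<Longrightarrow> T 0 x = x"
    "x \<in> space N \<Longrightarrow> T (g + h) x = T g (T h x)" for g h x
    using sys by (auto simp: prob_preserving_system_def)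
  have B_space: "B \<subseteq> space N" using B(1) by (rule sets.sets_into_space)
  have TB: "T g ` B = B" for g
  proof (intro equalityI subsetI)
    fix x assume x: "x \<in> B"
    then have "x = T g (T (- g) x)" using T(3)[of x] T(4)[of x g "- g"] B_space by auto
    then show "x \<in> T g ` B" using B(3)[OF x, of "- g"] by blast
  qed (use B(3) in auto)
  define A where "A = f ` B"
  have A: "A \<in> sets K" using image[OF sets.top] B_space by (simp add: A_def Int_absorb1)
  have SA: "S g ` A = A" for g
  proof -
    have "S g ` A = f ` (T g ` B)"
      unfolding A_def image_image using equivariant B_space by (intro image_cong) auto
    then show ?thesis by (simp add: TB A_def)
  qed
  define \<phi> where "\<phi> = the_inv_into B f"
  have \<phi>f: "\<phi> (f x) = x" if "x \<in> B" for x
    unfolding \<phi>_def using inj that by (rule the_inv_into_f_f)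
  have bij: "bij_betw \<phi> A B"
    unfolding \<phi>_def A_def using inj by (intro bij_betw_the_inv_into inj_on_imp_bij_betw)
  have \<phi>A: "\<phi> y \<in> B" "f (\<phi> y) = y" if "y \<in> A" for y
    using that \<phi>f by (auto simp: A_def)
  have inv: "the_inv_into A \<phi> x = f x" if "x \<in> B" for x
    using bij that \<phi>f by (intro the_inv_into_f_eq) (auto simp: bij_betw_def A_def)
  have pre: "\<phi> -` F \<inter> A = f ` (F \<inter> B)" for F
    using \<phi>A \<phi>f by (force simp: A_def)
  have emeasure_image: "emeasure ?M (f ` (F \<inter> B)) = emeasure N F" if F: "F \<in> sets N" for F
  proof -
    have "emeasure ?M (f ` (F \<inter> B)) = emeasure N (f -` (f ` (F \<inter> B)) \<inter> space N)"
      using f image[OF F] by (rule emeasure_distr)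
    also have "\<dots> = emeasure N F"
    proof (rule emeasure_eq_AE)
      show "AE x in N. (x \<in> f -` (f ` (F \<inter> B)) \<inter> space N) = (x \<in> F)"
        using B(2)
      proof eventually_elim
        case (elim x)
        then show ?case using B_space inj by (auto simp: inj_on_eq_iff)
      qed
    qed (use F image[OF F] f in \<open>auto intro: measurable_sets\<close>)
    finally show ?thesis .
  qed
  have N_B: "emeasure N B = 1" using N.emeasure_eq_1_AE[OF B(1,2)] .
  have M_A: "emeasure ?M A = 1"
    using emeasure_image[OF B(1)] N_B by (simp add: A_def)
  have sys': "prob_preserving_system ?M S"
    unfolding prob_preserving_system_def
  proof (intro conjI allI ballI)
    show "prob_space ?M" using f by (rule N.prob_space_distr)
    fix g
    show "S g \<in> ?M \<rightarrow>\<^sub>M ?M" using S(1) by simp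
    have "distr ?M ?M (S g) = distr ?M K (S g)" by (rule distr_cong) simp_all
    also have "\<dots> = distr N K (S g \<circ> f)" by (rule distr_distr[OF S(1) f])
    also have "\<dots> = distr N K (f \<circ> T g)" using equivariant by (intro distr_cong) auto
    also have "\<dots> = distr (distr N N (T g)) K f" by (rule distr_distr[OF f T(1), symmetric])
    finally show "distr ?M ?M (S g) = ?M" by (simp add: T(2))
  qed (use S in auto)
  have \<phi>_meas: "\<phi> \<in> restrict_space ?M A \<rightarrow>\<^sub>M restrict_space N B"
  proof (rule measurable_restrict_space2)
    show "\<phi> \<in> space (restrict_space ?M A) \<rightarrow> B"
      using \<phi>A by (auto simp: space_restrict_space)
    show "\<phi> \<in> restrict_space ?M A \<rightarrow>\<^sub>M N"
    proof (rule measurableI)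
      fix y assume "y \<in> space (restrict_space ?M A)"
      then show "\<phi> y \<in> space N" using \<phi>A B_space by (auto simp: space_restrict_space)
    next
      fix F assume F: "F \<in> sets N"
      have "\<phi> -` F \<inter> space (restrict_space ?M A) = f ` (F \<inter> B)"
        using pre sets.sets_into_space[OF A] by (auto simp: space_restrict_space Int_absorb2)
      then show "\<phi> -` F \<inter> space (restrict_space ?M A) \<in> sets (restrict_space ?M A)"
        using image[OF F] A by (subst sets_restrict_space_iff) (auto simp: A_def)
    qed
  qed
  have inv_meas: "the_inv_into A \<phi> \<in> restrict_space N B \<rightarrow>\<^sub>M restrict_space ?M A"
  proof (rule measurable_restrict_space2)
    show "the_inv_into A \<phi> \<in> space (restrict_space N B) \<rightarrow> A"
      using inv by (auto simp: space_restrict_space A_def)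
    have "f \<in> restrict_space N B \<rightarrow>\<^sub>M ?M" using f by (simp add: measurable_restrict_space1)
    then show "the_inv_into A \<phi> \<in> restrict_space N B \<rightarrow>\<^sub>M ?M"
      by (rule measurable_cong[THEN iffD1, rotated]) (simp add: inv space_restrict_space)
  qed
  have distr: "distr (restrict_space ?M A) (restrict_space N B) \<phi> = restrict_space N B"
  proof (rule measure_eqI)
    fix F assume "F \<in> sets (distr (restrict_space ?M A) (restrict_space N B) \<phi>)"
    then have F: "F \<in> sets N" "F \<subseteq> B" and F': "F \<in> sets (restrict_space N B)"
      using B(1) by (auto simp: sets_restrict_space_iff)
    have "emeasure (distr (restrict_space ?M A) (restrict_space N B) \<phi>) F =
        emeasure (restrict_space ?M A) (\<phi> -` F \<inter> space (restrict_space ?M A))"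
      by (rule emeasure_distr[OF \<phi>_meas F'])
    also have "\<phi> -` F \<inter> space (restrict_space ?M A) = f ` (F \<inter> B)"
      using pre sets.sets_into_space[OF A] by (auto simp: space_restrict_space Int_absorb2)
    also have "emeasure (restrict_space ?M A) \<dots> = emeasure ?M (f ` (F \<inter> B))"
      using A by (intro emeasure_restrict_space) (auto simp: A_def)
    also have "\<dots> = emeasure (restrict_space N B) F"
      using F B(1) by (simp add: emeasure_image emeasure_restrict_space)
    finally show "emeasure (distr (restrict_space ?M A) (restrict_space N B) \<phi>) F =
        emeasure (restrict_space N B) F" .
  qed simp
  have eq: "\<phi> (S g y) = T g (\<phi> y)" if y: "y \<in> A" for g y
  proof -
    obtain x where x: "x \<in> B" "y = f x" using y by (auto simp: A_def)
    have "S g y = f (T g x)" using x equivariant[of x g] B_space by auto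
    then show ?thesis using x \<phi>f B(3)[of x g] by simp
  qed
  show ?thesis
    unfolding isomorphic_systems_def
    using sys sys' A B(1) M_A N_B SA TB bij \<phi>_meas inv_meas distr eq
    by (intro conjI bexI[of _ A] bexI[of _ B] exI[of _ \<phi>] allI ballI) simp_all
qed

section \<open>The extended hull is isomorphic to the torus\<close>

context cut_project
begin

lemma sets_torus_haar:
  "haar_measure (torus_topology L) m \<Longrightarrow> sets m = sets (borel_of (torus_topology L))"
  by (simp add: haar_measure_def regular_borel_measure_def)

lemma space_torus_haar: "haar_measure (torus_topology L) m \<Longrightarrow> space m = torus L"
  using sets_eq_imp_space_eq[OF sets_torus_haar] by (simp add: topspace_torus_topology)

text \<open>Translation by an element of the torus, as in the definition of its Haar measure, is translation by
  any representative.\<close>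

lemma coset_plus: "c \<in> torus L \<Longrightarrow> (z +o L) + c = z +o c"
proof -
  assume "c \<in> torus L"
  then obtain x where x: "c = x +o L" by (auto simp: torus_def)
  have "L + L = L"
    using add_in zero_in by (auto simp: set_plus_def) (metis add_0)
  then show ?thesis by (simp add: x set_plus_rearrange elt_plus_coset)
qed

lemma emeasure_torus_translation:
  assumes m: "haar_measure (torus_topology L) m" and A: "A \<in> sets m"
  shows "emeasure m ((+o) z ` A) = emeasure m A"
proof -
  have "(+o) z ` A = (\<lambda>c. (z +o L) + c) ` A"
    using sets.sets_into_space[OF A]
    by (intro image_cong refl coset_plus[symmetric]) (auto simp: space_torus_haar[OF m])
  then show ?thesis
    using m A by (auto simp: haar_measure_def topspace_torus_topology)
qed

lemma torus_translation_vimage: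
  assumes "A \<subseteq> torus L"
  shows "(+o) z -` A \<inter> torus L = (+o) (- z) ` A"
proof (intro equalityI subsetI)
  fix c assume c: "c \<in> (+o) z -` A \<inter> torus L"
  then have "c = - z +o (z +o c)" by (auto simp: torus_def elt_plus_coset)
  then show "c \<in> (+o) (- z) ` A" using c by blast
next
  fix c assume "c \<in> (+o) (- z) ` A"
  then obtain a where a: "a \<in> A" "c = - z +o a" by blast
  with assms obtain x where "a = x +o L" by (auto simp: torus_def)
  then show "c \<in> (+o) z -` A \<inter> torus L" using a by (auto simp: elt_plus_coset)
qed

lemma torus_system:
  assumes m: "haar_measure (torus_topology L) m" "prob_space m"
  shows "prob_preserving_system m torus_shift"
  unfolding prob_preserving_system_def
proof (intro conjI allI ballI)
  fix g :: 'g
  have shift: "torus_shift g = (+o) (g, 0)"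
    by (simp add: torus_shift_def fun_eq_iff)
  show meas: "torus_shift g \<in> m \<rightarrow>\<^sub>M m"
    using continuous_map_measurable[OF continuous_torus_translation]
    by (simp add: shift cong: measurable_cong_sets add: sets_torus_haar[OF m(1)])
  show "distr m m (torus_shift g) = m"
  proof (rule measure_eqI)
    fix A assume "A \<in> sets (distr m m (torus_shift g))"
    then have A: "A \<in> sets m" by simp
    then have "A \<subseteq> torus L" using sets.sets_into_space[OF A] by (simp add: space_torus_haar[OF m(1)])
    then have "emeasure (distr m m (torus_shift g)) A = emeasure m ((+o) (- (g, 0)) ` A)"
      using emeasure_distr[OF meas A] torus_translation_vimage[of A "(g, 0)"]
      by (simp add: shift space_torus_haar[OF m(1)])
    then show "emeasure (distr m m (torus_shift g)) A = emeasure m A"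
      by (simp add: emeasure_torus_translation[OF m(1) A])
  qed simp
next
  fix c assume "c \<in> space m"
  then show "torus_shift (0::'g) c = c"
    by (auto simp: space_torus_haar[OF m(1)] torus_def torus_shift_coset simp flip: zero_prod_def)
next
  fix g h :: 'g and c assume "c \<in> space m"
  then show "torus_shift (g + h) c = torus_shift g (torus_shift h c)"
    by (auto simp: space_torus_haar[OF m(1)] torus_def torus_shift_coset simp flip: add.assoc)
qed (rule m(2))

text \<open>For a fixed coset \<open>c\<close>, the translate \<open>(0, h) + c\<close> meets \<open>UNIV \<times> C\<close> for almost every \<open>h\<close>. By Fubini there is
  an \<open>h\<close> that works for almost every \<open>c\<close>, and the Haar measure of the torus does not see the translation
  by \<open>(0, h)\<close>. This transfers null sets from the internal space to the torus.\<close>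

lemma conull_cosets:
  assumes m: "haar_measure (torus_topology L) m" "prob_space m"
    and \<mu>: "haar_measure euclidean \<mu>"
    and C: "C \<in> sets borel" "emeasure \<mu> (- C) = 0"
    and B: "(\<lambda>z. z +o L) ` (UNIV \<times> C) \<in> sets m"
  shows "AE c in m. c \<in> (\<lambda>z. z +o L) ` (UNIV \<times> C)"
proof -
  interpret H: haar_group \<mu> using lc_H \<mu> by unfold_locales
  interpret m: prob_space m by (rule m(2))
  interpret P: pair_sigma_finite m \<mu> ..
  let ?B = "(\<lambda>z. z +o L) ` (UNIV \<times> C)"
  note sets_m [measurable_cong] = sets_torus_haar[OF m(1)]
  note space_m = space_torus_haar[OF m(1)]
  obtain s where s: "s \<in> borel_of (torus_topology L) \<rightarrow>\<^sub>M borel" "\<forall>c\<in>torus L. s c +o L = c"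
    by (rule measurable_section)
  have [measurable]: "s \<in> m \<rightarrow>\<^sub>M borel" using s(1) by (simp cong: measurable_cong_sets add: sets_m)
  have S: "{z. z +o L \<in> ?B} \<in> sets borel"
    using measurable_sets[OF projection_measurable, of ?B] B by (simp add: sets_m vimage_def)
  have "AE h in \<mu>. (s c + (0, h)) +o L \<in> ?B" for c
  proof (rule AE_I')
    show "(\<lambda>h. h + snd (s c)) -` (- C) \<in> null_sets \<mu>"
      using C H.emeasure_translation[of "- C" "snd (s c)"] H.translation_sets[of "- C" "snd (s c)"]
      by (auto simp: null_sets_def intro: borel_comp)
    show "{h \<in> space \<mu>. (s c + (0, h)) +o L \<notin> ?B} \<subseteq> (\<lambda>h. h + snd (s c)) -` (- C)"
      by (auto simp: mem_Times_iff add.commute)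
  qed
  then have "AE c in m. AE h in \<mu>. (s c + (0, h)) +o L \<in> ?B" by simp
  moreover have "{z \<in> space (m \<Otimes>\<^sub>M \<mu>). (s (fst z) + (0, snd z)) +o L \<in> ?B} \<in> sets (m \<Otimes>\<^sub>M \<mu>)"
  proof -
    have "(\<lambda>z. s (fst z) + (0, snd z)) \<in> m \<Otimes>\<^sub>M \<mu> \<rightarrow>\<^sub>M borel"
      by (intro borel_measurable_add borel_measurable_Pair) measurable
    from measurable_sets[OF this S] show ?thesis by (simp add: vimage_def Int_def conj_commute)
  qed
  ultimately have "AE h in \<mu>. AE c in m. (s c + (0, h)) +o L \<in> ?B"
    by (subst (asm) P.AE_commute) auto
  then obtain N where N: "{h \<in> space \<mu>. \<not> (AE c in m. (s c + (0, h)) +o L \<in> ?B)} \<subseteq> N" "N \<in> null_sets \<mu>"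
    unfolding eventually_ae_filter by blast
  then have "N \<noteq> UNIV" using H.emeasure_UNIV_nonzero by (auto simp: null_sets_def)
  then obtain h where h: "AE c in m. (s c + (0, h)) +o L \<in> ?B" using N(1) by auto
  have eq: "(s c + (0, h)) +o L = (0, h) +o c" if "c \<in> torus L" for c
    using s(2) that elt_plus_coset[of "(0, h)" "s c"] by (simp add: add.commute)
  from h AE_space[of m] have "AE c in m. (0, h) +o c \<in> ?B"
    by eventually_elim (simp add: space_m eq)
  then have "emeasure m {c \<in> space m. (0, h) +o c \<notin> ?B} = 0"
  proof (subst (asm) AE_iff_measurable[OF _ refl])
    have "(+o) (0, h) \<in> m \<rightarrow>\<^sub>M m"
      using continuous_map_measurable[OF continuous_torus_translation]
      by (simp cong: measurable_cong_sets add: sets_m)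
    from measurable_sets[OF this B] have "(+o) (0, h) -` ?B \<inter> space m \<in> sets m" .
    then have "space m - ((+o) (0, h) -` ?B \<inter> space m) \<in> sets m" by blast
    moreover have "space m - ((+o) (0, h) -` ?B \<inter> space m) = {c \<in> space m. (0, h) +o c \<notin> ?B}" by auto
    ultimately show "{c \<in> space m. (0, h) +o c \<notin> ?B} \<in> sets m" by simp
  qed
  moreover have "{c \<in> space m. (0, h) +o c \<notin> ?B} = (+o) (- (0, h)) ` (torus L - ?B)"
  proof -
    have "{c \<in> space m. (0, h) +o c \<notin> ?B} = (+o) (0, h) -` (torus L - ?B) \<inter> torus L"
      by (auto simp: space_m torus_def elt_plus_coset)
    then show ?thesis by (simp only: torus_translation_vimage[OF Diff_subset])
  qed
  moreover have "torus L - ?B \<in> sets m" using sets.compl_sets[OF B] by (simp add: space_m)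
  ultimately have "emeasure m (torus L - ?B) = 0"
    using emeasure_torus_translation[OF m(1), of "torus L - ?B" "- (0, h)"] by simp
  then show ?thesis
    using \<open>torus L - ?B \<in> sets m\<close> by (intro AE_I'[of "torus L - ?B"]) (auto simp: null_sets_def space_m)
qed

lemma generic_cosets_sigma_compact:
  fixes C :: "nat \<Rightarrow> 'h set"
  assumes C: "\<forall>n. compact (C n)"
  obtains K :: "nat \<Rightarrow> ('g \<times> 'h) set" where "\<forall>n. compact (K n)" "\<forall>n. \<exists>k. K n \<subseteq> UNIV \<times> C k"
    "UNIV \<times> (\<Union>n. C n) = (\<Union>n. K n)"
proof -
  obtain R :: "nat \<Rightarrow> 'g set" where R: "\<forall>n. compact (R n)" "(\<Union>n. R n) = UNIV"
    using sigma_compact[OF lc_G] .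
  define K where "K n = R (fst (prod_decode n)) \<times> C (snd (prod_decode n))" for n
  show ?thesis
  proof
    show "\<forall>n. compact (K n)" using R(1) C by (simp add: K_def compact_Times)
    show "\<forall>n. \<exists>k. K n \<subseteq> UNIV \<times> C k" by (auto simp: K_def)
    show "UNIV \<times> (\<Union>n. C n) = (\<Union>n. K n)"
    proof (intro equalityI subsetI)
      fix z :: "'g \<times> 'h" assume "z \<in> UNIV \<times> (\<Union>n. C n)"
      then obtain n where "snd z \<in> C n" by auto
      moreover have "fst z \<in> (\<Union>n. R n)" using R(2) by simp
      then obtain j where "fst z \<in> R j" by blast
      ultimately have "z \<in> K (prod_encode (j, n))" by (simp add: K_def mem_Times_iff)
      then show "z \<in> (\<Union>n. K n)" by blast
    qed (auto simp: K_def)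
  qed
qed

text \<open>The cosets in \<open>B\<close> that belong to a closed set are represented by countably many compact sets, on each of
  which the pattern is continuous, so their image is a countable union of compact sets, hence Borel. Injectivity
  lets images commute with complements, which extends this from closed sets to Borel sets.\<close>

lemma image_generic_cosets:
  fixes C :: "nat \<Rightarrow> 'h set"
  defines "B \<equiv> (\<lambda>z. z +o L) ` (UNIV \<times> (\<Union>n. C n))"
  assumes C: "\<forall>n. compact (C n)"
    "\<forall>n. \<forall>l\<in>L. \<forall>h\<in>C n. \<exists>V. open V \<and> h \<in> V \<and> (\<forall>h'\<in>V \<inter> C n. (h' + snd l \<in> W) = (h + snd l \<in> W))"
    and inj: "inj_on (nu_G W) B"
  shows "B \<in> sets (borel_of (torus_topology L))"
    and "F \<in> sets (borel_of (torus_topology L)) \<Longrightarrow> nu_G W ` (F \<inter> B) \<in> sets hull_borel"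
proof -
  let ?X = "borel_of (torus_topology L)"
  obtain K :: "nat \<Rightarrow> ('g \<times> 'h) set" where K: "\<forall>n. compact (K n)" "\<forall>n. \<exists>k. K n \<subseteq> UNIV \<times> C k"
    "UNIV \<times> (\<Union>n. C n) = (\<Union>n. K n)"
    by (rule generic_cosets_sigma_compact[OF C(1)])
  have B_eq: "B = (\<Union>n. (\<lambda>z. z +o L) ` K n)"
    unfolding B_def K(3) by blast
  have "(\<lambda>z. z +o L) ` K n \<in> sets ?X" for n
    using K(1) by (intro closedin_in_borel_of closedin_image) auto
  then show B_sets: "B \<in> sets ?X" unfolding B_eq by blast
  have closed_image: "nu_G W ` (F \<inter> B) \<in> sets hull_borel" if F: "closedin (torus_topology L) F" for F
  proof -
    have "nu_G W ` (F \<inter> B) = (\<Union>n. pattern ` (K n \<inter> {z. z +o L \<in> F}))"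
      unfolding B_eq by (auto simp: pattern_def)
    moreover have "pattern ` (K n \<inter> {z. z +o L \<in> F}) \<in> sets hull_borel" for n
    proof -
      obtain k where k: "K n \<subseteq> UNIV \<times> C k" using K(2) by blast
      have "compact (K n \<inter> {z. z +o L \<in> F})"
        using F K(1) by (intro compact_Int_closed) (auto simp: closedin_torus)
      then show ?thesis
        using k C(2) by (intro pattern_image_compact[of "C k"]) auto
    qed
    ultimately show ?thesis by auto
  qed
  have diff: "nu_G W ` ((torus L - F) \<inter> B) = nu_G W ` (torus L \<inter> B) - nu_G W ` (F \<inter> B)"
    if "F \<subseteq> torus L" for F
  proof -
    have "(torus L - F) \<inter> B = (torus L \<inter> B) - (F \<inter> B)" by blast
    then show ?thesis
      using inj_on_image_set_diff[OF inj, of "torus L \<inter> B" "F \<inter> B"] that by auto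
  qed
  have all: "nu_G W ` (torus L \<inter> B) \<in> sets hull_borel"
    using closed_image[OF closedin_topspace] by (simp add: topspace_torus_topology)
  assume "F \<in> sets ?X"
  then have "F \<in> sigma_sets (torus L) {U. openin (torus_topology L) U}"
    by (simp only: sets_borel_of topspace_torus_topology)
  then show "nu_G W ` (F \<inter> B) \<in> sets hull_borel"
  proof (induction rule: sigma_sets.induct)
    case (Basic U)
    then have U: "openin (torus_topology L) U" by simp
    then have sub: "U \<subseteq> torus L" using openin_subset topspace_torus_topology by metis
    have "closedin (torus_topology L) (torus L - U)"
      using U closedin_diff[OF closedin_topspace U] by (simp add: topspace_torus_topology)
    from closed_image[OF this] all
    have "nu_G W ` ((torus L - (torus L - U)) \<inter> B) \<in> sets hull_borel"
      by (subst diff) auto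
    then show ?case using sub by (simp add: double_diff)
  next
    case Empty
    show ?case by simp
  next
    case (Compl F)
    have "F \<subseteq> torus L"
      using Compl.hyps by (rule sigma_sets_into_sp[rotated])
        (use openin_subset topspace_torus_topology in blast)
    then show ?case using all Compl.IH by (subst diff) auto
  next
    case (Union F)
    have "nu_G W ` ((\<Union>i. F i) \<inter> B) = (\<Union>i. nu_G W ` (F i \<inter> B))" by blast
    then show ?case using Union.IH by auto
  qed
qed

text \<open>The generic set of cosets consists of those that meet \<open>UNIV \<times> (\<Union>n. C n)\<close>. The physical coordinate is
  unrestricted, so this set is invariant under the action of the physical space.\<close>

lemma hull_isomorphic_torus:
  assumes \<mu>: "haar_measure euclidean \<mu>" and ap: "haar_aperiodic \<mu> W" and ne: "W \<noteq> {}"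
    and m: "haar_measure (torus_topology L) m" "prob_space m"
  shows "isomorphic_systems (mirsky_measure m L W) measure_shift m torus_shift"
proof -
  interpret H: haar_group \<mu> using lc_H \<mu> by unfold_locales
  note sets_m = sets_torus_haar[OF m(1)]
  note space_m = space_torus_haar[OF m(1)]
  have snd_add: "a + b \<in> snd ` L" if ab: "a \<in> snd ` L" "b \<in> snd ` L" for a b
  proof -
    obtain x y where "x \<in> L" "a = snd x" "y \<in> L" "b = snd y" using ab by blast
    then show ?thesis using add_in[of x y] by (intro image_eqI[of _ _ "x + y"]) auto
  qed
  have "countable (snd ` L)" "0 \<in> snd ` L"
    using countable zero_in by force+
  then obtain E where E: "E \<in> sets borel" "emeasure \<mu> (- E) = 0" "\<forall>h\<in>E. \<forall>d\<in>snd ` L. h + d \<in> E"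
    "\<forall>h\<in>E. \<forall>h'\<in>E. (\<forall>d\<in>snd ` L. (h + d \<in> W) = (h' + d \<in> W)) \<longrightarrow> h = h'"
    by (rule H.generic_points[OF window_borel window_compact _ dense_snd _ snd_add ap])
  define A where "A i = (\<lambda>h. h + snd (from_nat_into L i)) -` W" for i
  have "A i \<in> sets borel" for i
    unfolding A_def by (rule H.translation_sets[OF window_borel])
  then obtain C :: "nat \<Rightarrow> 'h set" where C: "\<forall>n. compact (C n)" "\<forall>n. C n \<subseteq> E"
    "emeasure \<mu> (- (\<Union>n. C n)) = 0"
    "\<forall>n i. \<forall>h\<in>C n. \<exists>V. open V \<and> h \<in> V \<and> (\<forall>h'\<in>V \<inter> C n. (h' \<in> A i) = (h \<in> A i))"
    by (rule H.conull_compact_clopen_pieces[OF _ E(1,2)])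
  have clopen: "\<forall>n. \<forall>l\<in>L. \<forall>h\<in>C n. \<exists>V. open V \<and> h \<in> V \<and>
      (\<forall>h'\<in>V \<inter> C n. (h' + snd l \<in> W) = (h + snd l \<in> W))"
  proof (intro allI ballI)
    fix n l h assume "l \<in> L" "h \<in> C n"
    then obtain i where "from_nat_into L i = l"
      using from_nat_into_surj[OF countable] by blast
    then show "\<exists>V. open V \<and> h \<in> V \<and> (\<forall>h'\<in>V \<inter> C n. (h' + snd l \<in> W) = (h + snd l \<in> W))"
      using C(4)[rule_format, OF \<open>h \<in> C n\<close>, of i] by (simp add: A_def)
  qed
  let ?B = "(\<lambda>z. z +o L) ` (UNIV \<times> (\<Union>n. C n))"
  have inj: "inj_on (nu_G W) ?B"
  proof (rule inj_onI)
    fix c c' assume c: "c \<in> ?B" and c': "c' \<in> ?B" and eq: "nu_G W c = nu_G W c'"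
    obtain z where z: "c = z +o L" "z \<in> UNIV \<times> (\<Union>n. C n)" using c by (rule imageE)
    obtain z' where z': "c' = z' +o L" "z' \<in> UNIV \<times> (\<Union>n. C n)" using c' by (rule imageE)
    have "snd z \<in> (\<Union>n. C n)" "snd z' \<in> (\<Union>n. C n)" using z(2) z'(2) by (simp_all only: mem_Times_iff)
    moreover have "(\<Union>n. C n) \<subseteq> E" using C(2) by blast
    ultimately have "snd z \<in> E" "snd z' \<in> E" by blast+
    moreover have "pattern z = pattern z'" using eq by (simp only: pattern_def z(1) z'(1))
    ultimately show "c = c'" unfolding z(1) z'(1) by (rule pattern_injective[OF E(3,4) ne])
  qed
  have B_sets: "?B \<in> sets m"
    unfolding sets_m by (rule image_generic_cosets(1)[OF C(1) clopen inj])
  have C_sets: "(\<Union>n. C n) \<in> sets borel"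
    using C(1) by (intro sets.countable_UN) (auto intro: borel_compact)
  have "isomorphic_systems (distr m hull_borel (nu_G W)) measure_shift m torus_shift"
  proof (rule isomorphic_systems_of_injective_factor)
    show "prob_preserving_system m torus_shift" by (rule torus_system[OF m])
    show "nu_G W \<in> m \<rightarrow>\<^sub>M hull_borel"
      using nu_G_measurable by (simp cong: measurable_cong_sets add: sets_m)
    show "measure_shift g \<in> hull_borel \<rightarrow>\<^sub>M hull_borel" for g by (rule measure_shift_measurable)
    have hull_sets: "sets \<nu> = sets borel" if "\<nu> \<in> space hull_borel" for \<nu>
      using that by (auto simp: topspace_vague_topology regular_sets)
    show "measure_shift 0 \<nu> = \<nu>" if "\<nu> \<in> space hull_borel" for \<nu>
      using hull_sets[OF that] by (simp add: measure_shift_def distr_id2)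
    show "measure_shift (g + h) \<nu> = measure_shift g (measure_shift h \<nu>)"
      if "\<nu> \<in> space hull_borel" for g h \<nu>
    proof -
      have "measure_shift g (measure_shift h \<nu>) = distr \<nu> borel ((+) g \<circ> (+) h)"
        unfolding measure_shift_def using translation_measurable hull_sets[OF that]
        by (intro distr_distr) (auto cong: measurable_cong_sets)
      then show ?thesis by (simp add: measure_shift_def o_def add.assoc)
    qed
    show "nu_G W (torus_shift g c) = measure_shift g (nu_G W c)" if "c \<in> space m" for g c
      using nu_G_torus_shift that by (simp add: space_m)
    show "?B \<in> sets m" by (rule B_sets)
    show "AE c in m. c \<in> ?B" by (rule conull_cosets[OF m \<mu> C_sets C(3) B_sets])
    show "torus_shift g c \<in> ?B" if "c \<in> ?B" for g c
    proof -
      obtain z where z: "c = z +o L" "z \<in> UNIV \<times> (\<Union>n. C n)" using \<open>c \<in> ?B\<close> by (rule imageE)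
      show ?thesis
        unfolding z(1) torus_shift_coset using z(2) by (intro imageI) (simp add: mem_Times_iff)
    qed
    show "inj_on (nu_G W) ?B" by (rule inj)
    show "nu_G W ` (F \<inter> ?B) \<in> sets hull_borel" if "F \<in> sets m" for F
      by (rule image_generic_cosets(2)[OF C(1) clopen inj]) (use that sets_m in simp)
  qed
  then show ?thesis by (simp add: mirsky_measure_def)
qed

end

theorem theorem2:
  fixes L :: "('g::{topological_ab_group_add,t2_space,second_countable_topology} \<times>
               'h::{topological_ab_group_add,t2_space,second_countable_topology}) set"
    and W :: "'h set"
    and mH :: "'h measure"
    and mX :: "('g \<times> 'h) set measure"
  assumes "cut_and_project_scheme L"
    and "haar_measure euclidean mH"
    and "haar_measure (torus_topology L) mX" and "prob_space mX"
    and "W \<in> sets borel"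
    and "compact (closure W)"
    and "haar_aperiodic mH W"
    and "W \<noteq> {}"
  shows "isomorphic_systems (mirsky_measure mX L W) measure_shift mX torus_shift"
proof -
  interpret cut_project L W using assms by unfold_locales
  show ?thesis using assms by (intro hull_isomorphic_torus)
qed

end
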